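(* Let $d=1$, $\mu>0$ and $\lambda+\mu\geq 0$. Assume that $a\in L^\infty(\mathbb{R};\mathbb{R})$ is real-valued and satisfies $$\int_{\mathbb{R}}|x||a(x)|\,dx<\infty\qquad\text{and}\qquad\lim_{R\to\infty}\|a\|_{L^\infty(\mathbb{R}\setminus B_R(0))}=0.$$ Let $z$ be a real eigenvalue of $A_a^\ast$. If either $z>0$ and $\int_{\mathbb{R}}a(x)\,dx<-4\sqrt{\lambda+2\mu}$, or $z<0$ and $\int_{\mathbb{R}}a(x)\,dx>4\sqrt{\lambda+2\mu}$, then $$|z|\geq(\lambda+2\mu)\left(\int_{\mathbb{R}}|x||a(x)|\,dx\right)^{-1}.$$
   Context: In dimension $d=1$ the Lamé operator is $-\Delta^\ast=-(\lambda+2\mu)\frac{d^2}{dx^2}$ with domain $H^2(\mathbb{R})$ (complex-valued functions). For a bounded damping $a$, the damped elastic wave operator is $$A_a^\ast=\begin{pmatrix}0&1\\ \Delta^\ast&-a\end{pmatrix},\qquad \mathcal{D}(A_a^\ast)=H^2(\mathbb{R})\times\dot H^1(\mathbb{R}),$$ where $\dot H^1$ is the homogeneous Sobolev space. A number $z\in\mathbb{C}$ is an eigenvalue of $A_a^\ast$ if there is a non-trivial $(\psi_1,\psi_2)\in\mathcal{D}(A_a^\ast)$ with $\psi_2=z\psi_1$ and $\Delta^\ast\psi_1-a\psi_2=z\psi_2$ almost everywhere. $B_R(0)=(-R,R)$. *)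

theory Defs
  imports "HOL-Analysis.Analysis" "HOL-Probability.Essential_Supremum"
begin

text \<open>
  Elements of Lebesgue and Sobolev spaces on the real line are represented by Lebesgue measurable
  functions; identities between them are understood almost everywhere.
\<close>

definition linf_norm :: "real set \<Rightarrow> (real \<Rightarrow> real) \<Rightarrow> ereal" where
  "linf_norm A f = esssup (restrict_space lebesgue A) (\<lambda>x. ereal \<bar>f x\<bar>)"

definition L_infinity :: "(real \<Rightarrow> real) set" where
  "L_infinity = {f \<in> borel_measurable lebesgue. linf_norm UNIV f < \<infinity>}"

definition L_2 :: "(real \<Rightarrow> complex) set" where
  "L_2 = {u \<in> borel_measurable lebesgue. integrable lebesgue (\<lambda>x. (cmod (u x))\<^sup>2)}"

definition L_1_loc :: "(real \<Rightarrow> complex) set" where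
  "L_1_loc = {u. \<forall>K. compact K \<longrightarrow> set_integrable lebesgue K u}"

text \<open>
  Test functions are real-valued; by linearity this gives the same weak derivatives as testing
  with complex-valued functions.
\<close>

definition test_functions :: "(real \<Rightarrow> real) set" where
  "test_functions =
     {\<phi>. (\<forall>n. (deriv ^^ n) \<phi> differentiable_on UNIV) \<and> compact (closure {x. \<phi> x \<noteq> 0})}"

definition has_weak_deriv :: "(real \<Rightarrow> complex) \<Rightarrow> (real \<Rightarrow> complex) \<Rightarrow> bool" where
  "has_weak_deriv u v \<longleftrightarrow> u \<in> L_1_loc \<and> v \<in> L_1_loc \<and>
     (\<forall>\<phi>\<in>test_functions.
        (LINT x|lebesgue. deriv \<phi> x *\<^sub>R u x) = - (LINT x|lebesgue. \<phi> x *\<^sub>R v x))"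

definition weakly_differentiable :: "(real \<Rightarrow> complex) \<Rightarrow> bool" where
  "weakly_differentiable u \<longleftrightarrow> (\<exists>v. has_weak_deriv u v)"

text \<open>
  A weak derivative is determined only almost everywhere; the following picks some representative,
  and is meaningful only for weakly differentiable functions.
\<close>

definition weak_deriv :: "(real \<Rightarrow> complex) \<Rightarrow> real \<Rightarrow> complex" where
  "weak_deriv u = (SOME v. has_weak_deriv u v)"

definition H_1_dot :: "(real \<Rightarrow> complex) set" where
  "H_1_dot = {u. weakly_differentiable u \<and> weak_deriv u \<in> L_2}"

definition H_2 :: "(real \<Rightarrow> complex) set" where
  "H_2 = {u \<in> L_2. weakly_differentiable u \<and> weak_deriv u \<in> L_2 \<and>
     weakly_differentiable (weak_deriv u) \<and> weak_deriv (weak_deriv u) \<in> L_2}"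

definition lame :: "real \<Rightarrow> real \<Rightarrow> (real \<Rightarrow> complex) \<Rightarrow> real \<Rightarrow> complex" where
  "lame lam mu u = (\<lambda>x. of_real (lam + 2 * mu) * weak_deriv (weak_deriv u) x)"

definition damped_domain :: "((real \<Rightarrow> complex) \<times> (real \<Rightarrow> complex)) set" where
  "damped_domain = H_2 \<times> H_1_dot"

definition damped_op :: "real \<Rightarrow> real \<Rightarrow> (real \<Rightarrow> real)
    \<Rightarrow> (real \<Rightarrow> complex) \<times> (real \<Rightarrow> complex) \<Rightarrow> (real \<Rightarrow> complex) \<times> (real \<Rightarrow> complex)" where
  "damped_op lam mu a = (\<lambda>(\<psi>1, \<psi>2). (\<psi>2, \<lambda>x. lame lam mu \<psi>1 x - of_real (a x) * \<psi>2 x))"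

definition damped_eigenvalue :: "real \<Rightarrow> real \<Rightarrow> (real \<Rightarrow> real) \<Rightarrow> complex \<Rightarrow> bool" where
  "damped_eigenvalue lam mu a z \<longleftrightarrow>
     (\<exists>\<psi>\<in>damped_domain.
        \<not> (AE x in lebesgue. fst \<psi> x = 0 \<and> snd \<psi> x = 0) \<and>
        (AE x in lebesgue. fst (damped_op lam mu a \<psi>) x = z * fst \<psi> x) \<and>
        (AE x in lebesgue. snd (damped_op lam mu a \<psi>) x = z * snd \<psi> x))"

end

theory Submission
  imports Defs "HOL-Real_Asymp.Real_Asymp"
begin

text \<open>
  With \<open>k = \<bar>z\<bar> / sqrt (\<lambda> + 2\<mu>)\<close> and \<open>V = z a / (\<lambda> + 2\<mu>)\<close>, the real or the imaginary part \<open>u\<close> of an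
  eigenfunction is a nontrivial square integrable solution of \<open>u'' = (k\<^sup>2 + V) u\<close>, where \<open>\<integral>V < -4k\<close>, and
  the claim becomes \<open>\<integral>\<bar>x\<bar>\<bar>V\<bar> \<ge> 1\<close>. If \<open>u\<close> has a zero, say in \<open>x \<ge> 0\<close>, then \<open>\<bar>u\<bar>\<close> attains a maximum
  further right; integrating \<open>u''\<close> against the distance to the last zero before that maximum gives
  the claim, as in Bargmann's bound. If \<open>u > 0\<close>, then \<open>-k\<^sup>2\<close> is the ground state energy, and the
  trial function \<open>exp (-k\<bar>x\<bar>)\<close> gives \<open>\<integral>V exp (-2k\<bar>x\<bar>) \<ge> -2k\<close>, whence
  \<open>\<integral>V \<ge> -2k - 2k \<integral>\<bar>x\<bar>\<bar>V\<bar>\<close>, so that again \<open>\<integral>\<bar>x\<bar>\<bar>V\<bar> > 1\<close>.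
\<close>

subsection \<open>Smooth functions\<close>

definition smooth :: "(real \<Rightarrow> real) \<Rightarrow> bool" where
  "smooth f \<longleftrightarrow> (\<forall>n. (deriv ^^ n) f differentiable_on UNIV)"

text \<open>Smoothness is coinductive: it suffices to exhibit a family of differentiable functions
  that contains the derivatives of its members, so no formula for the \<open>n\<close>-th derivative
  has to be found.\<close>

lemma smooth_coinduct:
  assumes "f \<in> X" and "\<And>g. g \<in> X \<Longrightarrow> g differentiable_on UNIV \<and> deriv g \<in> X"
  shows "smooth f"
proof -
  have "(deriv ^^ n) f \<in> X" for n
    by (induction n) (use assms in auto)
  then show ?thesis using assms(2) by (auto simp: smooth_def)
qed

lemma smooth_unfold: "smooth f \<longleftrightarrow> f differentiable_on UNIV \<and> smooth (deriv f)"
proof -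
  show ?thesis
  proof
    assume "smooth f"
    then show "f differentiable_on UNIV \<and> smooth (deriv f)"
      unfolding smooth_def by (metis funpow_0 funpow_Suc_right o_apply)
  next
    assume *: "f differentiable_on UNIV \<and> smooth (deriv f)"
    have "(deriv ^^ n) f differentiable_on UNIV" for n
      using * by (cases n) (auto simp: smooth_def funpow_Suc_right simp del: funpow.simps(2))
    then show "smooth f" by (simp add: smooth_def)
  qed
qed

lemma smooth_has_derivative:
  assumes "smooth f"
  shows "(f has_real_derivative deriv f x) (at x)"
  using assms unfolding smooth_unfold[of f]
  by (auto simp: differentiable_on_def DERIV_deriv_iff_real_differentiable)

lemma smooth_deriv: "smooth f \<Longrightarrow> smooth (deriv f)"
  using smooth_unfold by blast

lemma smoothI:
  assumes "\<And>x. (f has_real_derivative f' x) (at x)" "smooth f'"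
  shows "smooth f"
proof -
  have "deriv f = f'" using assms(1) by (auto intro: DERIV_imp_deriv)
  then show ?thesis
    using assms by (auto simp: smooth_unfold[of f] differentiable_on_def real_differentiable_def)
qed

lemma smooth_continuous: "smooth f \<Longrightarrow> continuous_on S f"
  by (meson DERIV_continuous_on has_field_derivative_at_within smooth_has_derivative)

text \<open>The sums of products of smooth functions form a set closed under derivation.\<close>

lemma smooth_sum_mult:
  assumes "\<And>p. p \<in> set ps \<Longrightarrow> smooth (fst p) \<and> smooth (snd p)"
  shows "smooth (\<lambda>x. \<Sum>p\<leftarrow>ps. fst p x * snd p x)"
proof (rule smooth_coinduct)
  let ?S = "\<lambda>ps x. \<Sum>p\<leftarrow>ps. fst p x * (snd p x :: real)"
  let ?X = "{?S ps | ps. \<forall>p\<in>set ps. smooth (fst p) \<and> smooth (snd p)}"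
  show "?S ps \<in> ?X" using assms by blast
  fix g assume "g \<in> ?X"
  then obtain ps where g: "g = ?S ps" and ps: "\<forall>p\<in>set ps. smooth (fst p) \<and> smooth (snd p)" by blast
  \<comment> \<open>The product rule turns each product into two, so the derivative is again a sum
    of products.\<close>
  define qs where "qs = concat (map (\<lambda>p. [(deriv (fst p), snd p), (fst p, deriv (snd p))]) ps)"
  have "(?S ps has_real_derivative ?S qs x) (at x)" for x
    unfolding qs_def using ps
  proof (induction ps)
    case (Cons p ps)
    then have "(?S ps has_real_derivative ?S (concat (map (\<lambda>p. [(deriv (fst p), snd p), (fst p, deriv (snd p))]) ps)) x) (at x)"
      by simp
    moreover have "((\<lambda>x. fst p x * snd p x) has_real_derivative
      deriv (fst p) x * snd p x + deriv (snd p) x * fst p x) (at x)"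
      using Cons.prems by (intro DERIV_mult smooth_has_derivative) auto
    ultimately show ?case using DERIV_add by (fastforce simp: algebra_simps)
  qed simp
  moreover have "\<forall>p\<in>set qs. smooth (fst p) \<and> smooth (snd p)"
    using ps by (auto simp: qs_def intro: smooth_deriv)
  moreover from calculation have "deriv g = ?S qs" by (auto simp: g intro: DERIV_imp_deriv)
  ultimately show "g differentiable_on UNIV \<and> deriv g \<in> ?X"
    by (auto simp: g differentiable_on_def real_differentiable_def)
qed

lemma smooth_mult: "smooth f \<Longrightarrow> smooth g \<Longrightarrow> smooth (\<lambda>x. f x * g x)"
  using smooth_sum_mult[of "[(f, g)]"] by simp

lemma smooth_const: "smooth (\<lambda>_. c)"
  by (rule smooth_coinduct[of _ "range (\<lambda>c _. c)"]) auto

lemma smooth_add: "smooth f \<Longrightarrow> smooth g \<Longrightarrow> smooth (\<lambda>x. f x + g x)"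
  using smooth_sum_mult[of "[(f, \<lambda>_. 1), (g, \<lambda>_. 1)]"] smooth_const by fastforce

lemma smooth_affine:
  assumes "smooth f"
  shows "smooth (\<lambda>x. f (c * x + d))"
proof (rule smooth_coinduct)
  \<comment> \<open>The scalar \<open>e\<close> collects the powers of \<open>c\<close> that the
    chain rule produces.\<close>
  let ?X = "{\<lambda>x. e * g (c * x + d) | e g. smooth g}"
  show "(\<lambda>x. f (c * x + d)) \<in> ?X" using assms by (auto intro!: exI[of _ 1] exI[of _ f])
  fix h assume "h \<in> ?X"
  then obtain e g where h: "h = (\<lambda>x. e * g (c * x + d))" "smooth g" by blast
  have d: "(h has_real_derivative (e * c) * deriv g (c * x + d)) (at x)" for x
    unfolding h(1)
    by (auto intro!: derivative_eq_intros DERIV_chain2[OF smooth_has_derivative[OF h(2)]])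
  then have "deriv h = (\<lambda>x. (e * c) * deriv g (c * x + d))" by (auto intro: DERIV_imp_deriv)
  then show "h differentiable_on UNIV \<and> deriv h \<in> ?X"
    using d h(2) smooth_deriv by (auto simp: differentiable_on_def real_differentiable_def)
qed

section \<open>Smooth bump functions\<close>

text \<open>\<open>flat 1\<close> is the classical smooth function \<open>exp (-1/x)\<close>,
  extended by 0 to the left half line. The polynomial factor in \<open>1/x\<close> makes the family
  closed under derivation.\<close>

definition flat :: "real poly \<Rightarrow> real \<Rightarrow> real" where
  "flat p x = (if x > 0 then poly p (1 / x) * exp (- 1 / x) else 0)"

lemma flat_deriv_0: "(flat p has_real_derivative 0) (at 0)"
proof -
  have poly_exp: "((\<lambda>t. poly q t * exp (-t)) \<longlongrightarrow> 0) at_top" for q :: "real poly"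
  proof -
    have "((\<lambda>t. \<Sum>i\<le>degree q. coeff q i * (t ^ i / exp t)) \<longlongrightarrow> (\<Sum>i\<le>degree q. coeff q i * 0)) at_top"
      by (intro tendsto_intros tendsto_power_div_exp_0)
    then show ?thesis by (simp add: poly_altdef sum_distrib_right exp_minus divide_inverse mult.assoc)
  qed
  \<comment> \<open>\<open>pCons 0 p\<close> is \<open>p\<close> times its variable; at
    \<open>1/x\<close> this accounts for the division by \<open>x\<close> in the difference quotient
    at 0.\<close>
  have "((\<lambda>x. poly (pCons 0 p) (1 / x) * exp (- (1 / x))) \<longlongrightarrow> 0) (at_right 0)"
    using filterlim_compose[OF poly_exp[of "pCons 0 p"] filterlim_inverse_at_top_right]
    by (simp add: divide_inverse)
  then have "((\<lambda>x. (flat p x - flat p 0) / (x - 0)) \<longlongrightarrow> 0) (at_right 0)"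
    by (rule Lim_transform_eventually) (auto simp: eventually_at_filter flat_def)
  moreover have "((\<lambda>x. (flat p x - flat p 0) / (x - 0)) \<longlongrightarrow> 0) (at_left 0)"
    by (rule tendsto_eventually) (auto simp: eventually_at_filter flat_def)
  ultimately show ?thesis
    by (simp add: has_field_derivative_iff filterlim_split_at)
qed

text \<open>For \<open>x > 0\<close> the derivative of \<open>p(1/x) exp(-1/x)\<close> is
  \<open>(p(1/x) - p'(1/x)) exp(-1/x) / x^2\<close>; the monomial encodes the factor
  \<open>1/x^2\<close>.\<close>

lemma flat_deriv: "(flat p has_real_derivative flat (monom 1 2 * (p - pderiv p)) x) (at x)"
proof -
  consider "x = 0" | "x < 0" | "x > 0" by linarith
  then show ?thesis
  proof cases
    case 1
    then show ?thesis using flat_deriv_0 by (simp add: flat_def)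
  next
    case 2
    have "(flat p has_real_derivative 0) (at x)"
    proof (rule has_field_derivative_transform_within_open)
      show "((\<lambda>_. 0) has_real_derivative 0) (at x)" by simp
      show "open {..<0::real}" by simp
    qed (use 2 in \<open>auto simp: flat_def\<close>)
    then show ?thesis using 2 by (simp add: flat_def)
  next
    case 3
    show ?thesis
    proof (rule has_field_derivative_transform_within_open)
      have "((\<lambda>x. poly p (1 / x)) has_real_derivative poly (pderiv p) (1 / x) * (- 1 / x\<^sup>2)) (at x)"
        using 3 by (intro DERIV_chain2[OF poly_DERIV])
          (auto intro!: derivative_eq_intros simp: power2_eq_square)
      then show "((\<lambda>x. poly p (1 / x) * exp (- 1 / x)) has_real_derivative flat (monom 1 2 * (p - pderiv p)) x) (at x)"
        using 3 by (auto intro!: derivative_eq_intros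
            simp: flat_def poly_monom power2_eq_square field_simps)
      show "open {0::real<..}" by simp
    qed (use 3 in \<open>auto simp: flat_def\<close>)
  qed
qed

lemma smooth_flat: "smooth (flat p)"
proof (rule smooth_coinduct)
  show "flat p \<in> range flat" by simp
  fix g assume "g \<in> range flat"
  then obtain p where g: "g = flat p" by blast
  have "deriv g = flat (monom 1 2 * (p - pderiv p))"
    unfolding g by (intro ext DERIV_imp_deriv flat_deriv)
  then show "g differentiable_on UNIV \<and> deriv g \<in> range flat"
    using flat_deriv by (auto simp: g differentiable_on_def real_differentiable_def)
qed

text \<open>The factor \<open>Suc n\<close> steepens both flanks while the support stays fixed, so
  that the bumps converge pointwise to the indicator function of the open interval.\<close>

definition bump :: "real \<Rightarrow> real \<Rightarrow> nat \<Rightarrow> real \<Rightarrow> real" where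
  "bump a b n x = flat 1 (real (Suc n) * (x - a)) * flat 1 (real (Suc n) * (b - x))"

lemma smooth_bump: "smooth (bump a b n)"
proof -
  have "smooth (\<lambda>x. flat 1 (real (Suc n) * x + - real (Suc n) * a) * flat 1 (- real (Suc n) * x + real (Suc n) * b))"
    by (intro smooth_mult smooth_affine smooth_flat)
  then show ?thesis by (simp only: bump_def[abs_def] right_diff_distrib) (simp add: algebra_simps)
qed

lemma bump_outside: "x \<notin> {a<..<b} \<Longrightarrow> bump a b n x = 0"
  by (auto simp: bump_def flat_def zero_less_mult_iff)

lemma bump_bounds: "0 \<le> bump a b n x" "bump a b n x \<le> 1"
  by (auto simp: bump_def flat_def divide_simps intro!: mult_le_one)

lemma bump_pos: "x \<in> {a<..<b} \<Longrightarrow> bump a b n x > 0"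
  by (auto simp: bump_def flat_def)

lemma bump_limit: "(\<lambda>n. bump a b n x) \<longlonglongrightarrow> indicator {a<..<b} x"
proof (cases "x \<in> {a<..<b}")
  case True
  have "(\<lambda>n. exp (- 1 / (real (Suc n) * c))) \<longlonglongrightarrow> 1" if "c > 0" for c :: real
    using that by real_asymp
  from tendsto_mult[OF this[of "x - a"] this[of "b - x"]] show ?thesis
    using True by (simp add: bump_def flat_def)
qed (simp add: bump_outside)

subsection \<open>Primitives of locally integrable functions\<close>

text \<open>This expresses that \<open>U\<close> is locally absolutely continuous with derivative
  \<open>v\<close> almost everywhere. Absolute integrability ensures that the gauge integral is a
  Lebesgue integral.\<close>

definition primitive :: "(real \<Rightarrow> real) \<Rightarrow> (real \<Rightarrow> real) \<Rightarrow> bool" where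
  "primitive v U \<longleftrightarrow> (\<forall>x y. x \<le> y \<longrightarrow>
     v absolutely_integrable_on {x..y} \<and> (v has_integral (U y - U x)) {x..y})"

lemma primitiveD:
  assumes "primitive v U" "x \<le> y"
  shows "v absolutely_integrable_on {x..y}" "(v has_integral (U y - U x)) {x..y}"
    "v integrable_on {x..y}" "integral {x..y} v = U y - U x"
  using assms unfolding primitive_def by (auto simp: integral_unique integrable_on_def)

lemma primitive_exists:
  assumes v: "\<And>x y. v absolutely_integrable_on {x..y}"
  shows "\<exists>U. primitive v U \<and> U 0 = c"
proof -
  have vi: "v integrable_on {x..y}" for x y
    using v[of x y] by (rule set_lebesgue_integral_eq_integral)
  define U where "U x = c + (if 0 \<le> x then integral {0..x} v else - integral {x..0} v)" for x
  have "U y - U x = integral {x..y} v" if "x \<le> y" for x y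
  proof -
    consider "0 \<le> x" | "x < 0" "0 \<le> y" | "y < 0" by linarith
    then show ?thesis
    proof cases
      case 1
      then show ?thesis
        using Henstock_Kurzweil_Integration.integral_combine[of 0 x y v] vi that by (simp add: U_def)
    next
      case 2
      then show ?thesis
        using Henstock_Kurzweil_Integration.integral_combine[of x 0 y v] vi that by (simp add: U_def)
    next
      case 3
      then show ?thesis
        using Henstock_Kurzweil_Integration.integral_combine[of x y 0 v] vi that by (simp add: U_def)
    qed
  qed
  then have "primitive v U"
    using v vi by (auto simp: primitive_def has_integral_integrable_integral)
  moreover have "U 0 = c" by (simp add: U_def)
  ultimately show ?thesis by blast
qed

lemma primitive_continuous:
  assumes "primitive v U"
  shows "continuous_on S U"
proof -
  have "isCont U x" for x
  proof -
    have "continuous_on {x-1..x+1} (\<lambda>y. integral {x-1..y} v)"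
      using primitiveD[OF assms, of "x-1" "x+1"] by (intro indefinite_integral_continuous_1) simp
    then have "continuous_on {x-1..x+1} (\<lambda>y. U (x-1) + integral {x-1..y} v)"
      by (intro continuous_intros)
    also have "?this \<longleftrightarrow> continuous_on {x-1..x+1} U"
      by (intro continuous_on_cong) (auto simp: primitiveD[OF assms])
    finally show ?thesis
      by (rule continuous_on_interior) auto
  qed
  then show ?thesis by (simp add: continuous_at_imp_continuous_on)
qed

text \<open>Serves to replace a weak derivative by its continuous representative, or by the
  right-hand side of the differential equation.\<close>

lemma primitive_spike:
  assumes "primitive v U" and ae: "AE x in lebesgue. v x = w x"
  shows "primitive w U"
proof -
  obtain N where N: "N \<in> null_sets lebesgue" "{x \<in> space lebesgue. v x \<noteq> w x} \<subseteq> N"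
    using ae unfolding eventually_ae_filter by (elim bexE) (rule that)
  then have "negligible N" by (simp add: negligible_iff_null_sets)
  have eq: "w x = v x" if "x \<notin> N" for x using N(2) that by force
  show ?thesis
    unfolding primitive_def
  proof (intro allI impI conjI)
    fix x y :: real assume "x \<le> y"
    note * = primitiveD[OF assms(1) this]
    show "w absolutely_integrable_on {x..y}"
      by (rule absolutely_integrable_spike[OF *(1) \<open>negligible N\<close>]) (use eq in auto)
    show "(w has_integral U y - U x) {x..y}"
      by (rule has_integral_spike[OF \<open>negligible N\<close> _ *(2)]) (use eq in auto)
  qed
qed

lemma primitive_has_derivative:
  assumes "primitive v U" "\<And>x. isCont v x"
  shows "(U has_real_derivative v x) (at x)"
proof -
  have c: "continuous_on {x-1..x+1} v" using assms(2) by (simp add: continuous_at_imp_continuous_on)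
  have "((\<lambda>y. integral {x-1..y} v) has_real_derivative v x) (at x within {x-1..x+1})"
    unfolding has_real_derivative_iff_has_vector_derivative
    by (rule integral_has_vector_derivative[OF c]) simp
  then have "((\<lambda>y. U (x-1) + integral {x-1..y} v) has_real_derivative v x) (at x within {x-1..x+1})"
    by (auto intro!: derivative_eq_intros)
  then have "(U has_real_derivative v x) (at x within {x-1..x+1})"
  proof (rule has_field_derivative_transform_within[where d = 1])
    fix y assume "y \<in> {x-1..x+1}"
    then show "U (x-1) + integral {x-1..y} v = U y"
      using primitiveD(4)[OF assms(1), of "x-1" y] by simp
  qed auto
  then have "(U has_real_derivative v x) (at x within {x-1<..<x+1})"
    by (rule DERIV_subset) auto
  then show ?thesis using at_within_open[of x "{x-1<..<x+1}"] by auto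
qed

section \<open>Integration by parts\<close>

lemma absolutely_integrable_mult_continuous:
  fixes v h :: "real \<Rightarrow> real"
  assumes "v absolutely_integrable_on {a..b}" "continuous_on {a..b} h"
  shows "(\<lambda>x. v x * h x) absolutely_integrable_on {a..b}"
proof -
  have "bounded (h ` {a..b})"
    by (intro compact_imp_bounded compact_continuous_image assms) auto
  moreover have "h \<in> borel_measurable (lebesgue_on {a..b})"
    using assms(2) by (intro continuous_imp_measurable_on_sets_lebesgue) auto
  ultimately have "(\<lambda>x. h x * v x) absolutely_integrable_on {a..b}"
    using assms(1) by (intro absolutely_integrable_bounded_measurable_product_real) auto
  then show ?thesis by (simp add: mult.commute)
qed

text \<open>
  The defect of the formula on \<open>{x..y}\<close> is at most a constant times \<open>(y - x) \<integral>\<^bsub>x\<^esub>\<^bsup>y\<^esup> \<bar>v\<bar>\<close>, hence as a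
  function of the right end point it has derivative 0 everywhere; this avoids differentiating \<open>W\<close>.
\<close>

lemma primitive_parts:
  assumes W: "primitive v W" and ab: "a \<le> b"
    and h: "\<And>x. x \<in> {a..b} \<Longrightarrow> (h has_real_derivative h' x) (at x within {a..b})"
    and h': "continuous_on {a..b} h'"
  shows "((\<lambda>x. v x * h x + W x * h' x) has_integral (W b * h b - W a * h a)) {a..b}"
proof -
  have hc: "continuous_on {a..b} h" using h by (rule DERIV_continuous_on)
  have Wc: "continuous_on S W" for S using W by (rule primitive_continuous)
  have vi: "v absolutely_integrable_on {x..y}" for x y
    using primitiveD(1)[OF W] by (cases "x \<le> y") auto
  obtain M where M: "\<And>x. x \<in> {a..b} \<Longrightarrow> \<bar>h' x\<bar> \<le> M" "M \<ge> 0"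
  proof -
    have "bounded (h' ` {a..b})" by (intro compact_imp_bounded compact_continuous_image h') auto
    then obtain M where "\<forall>x\<in>{a..b}. \<bar>h' x\<bar> \<le> M" by (auto simp: bounded_iff)
    then show thesis using that[of "max M 0"] by fastforce
  qed
  have h_lip: "\<bar>h x - h y\<bar> \<le> M * \<bar>x - y\<bar>" if "x \<in> {a..b}" "y \<in> {a..b}" for x y
    using field_differentiable_bound[of "{a..b}" h h' M] h M that
    by (auto simp: norm_minus_commute abs_minus_commute)
  \<comment> \<open>The primitive \<open>N\<close> of \<open>\<bar>v\<bar>\<close> is continuous and
    increasing, and its increments bound those of \<open>W\<close>.\<close>
  have va: "(\<lambda>x. \<bar>v x\<bar>) absolutely_integrable_on {x..y}" for x y
    using absolutely_integrable_norm[OF vi] by (simp add: o_def)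
  obtain N where N: "primitive (\<lambda>x. \<bar>v x\<bar>) N" using primitive_exists[OF va] by blast
  have W_lip: "\<bar>W y - W x\<bar> \<le> N y - N x" if "x \<le> y" for x y
    using integral_norm_bound_integral[OF primitiveD(3)[OF W that] primitiveD(3)[OF N that]]
    by (simp add: primitiveD(4)[OF W that] primitiveD(4)[OF N that])
  have N_mono: "N x \<le> N y" if "x \<le> y" for x y using W_lip[OF that] by linarith
  define F where "F x = v x * h x + W x * h' x" for x
  have sub: "continuous_on {x..y} f" if "a \<le> x" "y \<le> b" "continuous_on {a..b} f" for x y f
    using that by (auto elim!: continuous_on_subset)
  have Fi: "F integrable_on {x..y}" if "a \<le> x" "y \<le> b" for x y
    unfolding F_def using sub[OF that] hc h' Wc
    by (intro integrable_add set_lebesgue_integral_eq_integral(1)[OF absolutely_integrable_mult_continuous]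
        integrable_continuous_interval continuous_intros vi) auto
  define K where "K x = integral {a..x} F - W x * h x" for x
  have K_lip: "\<bar>K y - K x\<bar> \<le> 2 * M * (y - x) * (N y - N x)" if "a \<le> x" "x \<le> y" "y \<le> b" for x y
  proof -
    have 1: "integral {a..y} F - integral {a..x} F = integral {x..y} F"
      using Henstock_Kurzweil_Integration.integral_combine[of a x y F] Fi that by simp
    have i1: "((\<lambda>t. v t * (h t - h y)) has_integral integral {x..y} (\<lambda>t. v t * (h t - h y))) {x..y}"
      using sub[of x y] hc that
      by (intro integrable_integral set_lebesgue_integral_eq_integral(1)[OF absolutely_integrable_mult_continuous]
          vi continuous_intros) auto
    have i2: "((\<lambda>t. (W t - W x) * h' t) has_integral integral {x..y} (\<lambda>t. (W t - W x) * h' t)) {x..y}"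
      using sub[of x y] h' that Wc by (intro integrable_integral integrable_continuous_interval continuous_intros) auto
    have i3: "(h' has_integral (h y - h x)) {x..y}"
    proof (rule fundamental_theorem_of_calculus[OF that(2)])
      fix t assume t: "t \<in> {x..y}"
      then have "(h has_real_derivative h' t) (at t within {x..y})"
        using that by (intro DERIV_subset[OF h]) auto
      then show "(h has_vector_derivative h' t) (at t within {x..y})"
        by (simp add: has_real_derivative_iff_has_vector_derivative)
    qed
    \<comment> \<open>With \<open>h\<close> frozen at \<open>y\<close> and \<open>W\<close> frozen
      at \<open>x\<close>, the integrand becomes \<open>h y * v t + W x * h' t\<close>, whose
      integral is exactly \<open>W y * h y - W x * h x\<close>. What is left are two deviation
      integrals, each bounded by a product of two small factors.\<close>
    have "((\<lambda>t. v t * (h t - h y) + (W t - W x) * h' t + (h y * v t + W x * h' t)) has_integral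
       integral {x..y} (\<lambda>t. v t * (h t - h y)) + integral {x..y} (\<lambda>t. (W t - W x) * h' t)
        + (h y * (W y - W x) + W x * (h y - h x))) {x..y}"
      by (intro has_integral_add i1 i2 has_integral_mult_right primitiveD(2)[OF W] i3 that)
    then have "integral {x..y} F = integral {x..y} (\<lambda>t. v t * (h t - h y))
        + integral {x..y} (\<lambda>t. (W t - W x) * h' t) + (h y * (W y - W x) + W x * (h y - h x))"
      unfolding F_def by (subst integral_unique[symmetric]) (auto simp: algebra_simps)
    then have eq: "K y - K x = integral {x..y} (\<lambda>t. v t * (h t - h y)) + integral {x..y} (\<lambda>t. (W t - W x) * h' t)"
      using 1 unfolding K_def by (simp add: algebra_simps)
    have b1: "norm (integral {x..y} (\<lambda>t. v t * (h t - h y))) \<le> integral {x..y} (\<lambda>t. M * (y - x) * \<bar>v t\<bar>)"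
    proof (rule integral_norm_bound_integral)
      show "(\<lambda>t. M * (y - x) * \<bar>v t\<bar>) integrable_on {x..y}"
        using primitiveD(3)[OF N that(2)] by (rule integrable_on_mult_right)
      fix t assume t: "t \<in> {x..y}"
      then have "\<bar>h t - h y\<bar> \<le> M * \<bar>t - y\<bar>" using h_lip[of t y] that by auto
      also have "\<dots> \<le> M * (y - x)" using t M(2) by (intro mult_left_mono) auto
      finally show "norm (v t * (h t - h y)) \<le> M * (y - x) * \<bar>v t\<bar>"
        by (metis abs_ge_zero abs_mult mult.commute mult_right_mono real_norm_def)
    qed (use i1 in blast)
    have b2: "norm (integral {x..y} (\<lambda>t. (W t - W x) * h' t)) \<le> integral {x..y} (\<lambda>t. (N y - N x) * M)"
    proof (rule integral_norm_bound_integral)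
      fix t assume t: "t \<in> {x..y}"
      then have "\<bar>W t - W x\<bar> \<le> N y - N x" using W_lip[of x t] N_mono[of t y] by auto
      then show "norm ((W t - W x) * h' t) \<le> (N y - N x) * M"
        using M t that unfolding real_norm_def abs_mult by (intro mult_mono) auto
    qed (use has_integral_integrable[OF i2] in auto)
    show ?thesis
    proof -
      have "integral {x..y} (\<lambda>t. M * (y - x) * \<bar>v t\<bar>) = M * (y - x) * (N y - N x)"
        by (simp add: primitiveD(4)[OF N that(2)])
      moreover have "integral {x..y} (\<lambda>t. (N y - N x) * M) = M * (y - x) * (N y - N x)"
        using that by simp
      ultimately show ?thesis
        using b1 b2 abs_triangle_ineq[of "integral {x..y} (\<lambda>t. v t * (h t - h y))"
            "integral {x..y} (\<lambda>t. (W t - W x) * h' t)"]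
        unfolding eq real_norm_def by linarith
    qed
  qed
  have K_lip': "\<bar>K y - K x\<bar> \<le> 2 * M * \<bar>N y - N x\<bar> * \<bar>y - x\<bar>" if "x \<in> {a..b}" "y \<in> {a..b}" for x y
  proof (cases "x \<le> y")
    case True then show ?thesis using K_lip[of x y] that N_mono[of x y] by (simp add: mult.assoc mult.commute[of "y - x"])
  next
    case False then show ?thesis using K_lip[of y x] that N_mono[of y x]
      by (simp add: mult.assoc mult.commute[of "x - y"] abs_minus_commute[of "K y"])
  qed
  \<comment> \<open>The difference quotient is at most \<open>2 * M * \<bar>N y - N x\<bar>\<close>,
    which tends to 0 because \<open>N\<close> is continuous.\<close>
  have "(K has_real_derivative 0) (at x within {a..b})" if x: "x \<in> {a..b}" for x
  proof -
    have "(N \<longlongrightarrow> N x) (at x within {a..b})"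
      using primitive_continuous[OF N, of "{a..b}"] x by (simp add: continuous_on)
    then have "((\<lambda>y. 2 * M * \<bar>N y - N x\<bar>) \<longlongrightarrow> 0) (at x within {a..b})"
      by (auto intro!: tendsto_eq_intros)
    then have "((\<lambda>y. (K y - K x) / (y - x)) \<longlongrightarrow> 0) (at x within {a..b})"
    proof (rule Lim_null_comparison[rotated])
      show "\<forall>\<^sub>F y in at x within {a..b}. norm ((K y - K x) / (y - x)) \<le> 2 * M * \<bar>N y - N x\<bar>"
        unfolding eventually_at_filter
        by (intro always_eventually) (use K_lip'[OF x] in \<open>auto simp: abs_divide divide_simps\<close>)
    qed
    then show ?thesis by (simp add: has_field_derivative_iff)
  qed
  then obtain c where "\<forall>x\<in>{a..b}. K x = c"
    using has_field_derivative_zero_constant[of "{a..b}" K] by auto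
  then have "K b = K a" using ab by auto
  then have "integral {a..b} F = W b * h b - W a * h a" by (simp add: K_def)
  then show ?thesis using Fi[of a b] ab unfolding F_def by (simp add: has_integral_integrable_integral)
qed

subsection \<open>The one-dimensional Schroedinger equation\<close>

lemma primitive_reflect:
  assumes "primitive v U"
  shows "primitive (\<lambda>x. v (-x)) (\<lambda>x. - U (-x))"
  unfolding primitive_def
proof (intro allI impI conjI)
  fix x y :: real assume "x \<le> y"
  then have "-y \<le> -x" by simp
  note * = primitiveD[OF assms this]
  show "(\<lambda>x. v (-x)) absolutely_integrable_on {x..y}"
    using *(1) absolutely_integrable_reflect_real[where f = v and a = "-y" and b = "-x"] by simp
  show "((\<lambda>x. v (-x)) has_integral - U (-y) - - U (-x)) {x..y}"
    using *(2) has_integral_reflect_real[of v _ "-x" "-y"] by simp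
qed

lemma lebesgue_integral_reflect_real:
  fixes f :: "real \<Rightarrow> real"
  shows "(LINT x|lebesgue. f (-x)) = (LINT x|lebesgue. f x)"
    "integrable lebesgue (\<lambda>x. f (-x)) \<longleftrightarrow> integrable lebesgue f"
  using lebesgue_integral_real_affine[of "-1" f 0] lebesgue_integrable_real_affine_iff[of "-1" f 0]
  by simp_all

lemma integrable_lebesgue_Icc:
  fixes f :: "real \<Rightarrow> real"
  assumes "integrable lebesgue f"
  shows "f absolutely_integrable_on {a..b}"
  using assms unfolding set_integrable_def
  by (intro integrable_mult_indicator) auto

lemma integral_Icc_le_lebesgue:
  fixes f :: "real \<Rightarrow> real"
  assumes "integrable lebesgue f" "\<And>x. f x \<ge> 0"
  shows "integral {a..b} f \<le> (LINT x|lebesgue. f x)"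
  unfolding integral_lebesgue[OF assms(1), symmetric]
  by (rule integral_subset_le)
    (use assms integrable_on_lebesgue[OF assms(1)]
      set_lebesgue_integral_eq_integral(1)[OF integrable_lebesgue_Icc[OF assms(1)]] in auto)

text \<open>Otherwise the integral of \<open>U^2\<close> over an interval of length \<open>n\<close>
  would be at least \<open>e^2 * n\<close> for every \<open>n\<close>. This weak form of decay at
  infinity is enough to locate an interior maximum later.\<close>

lemma L2_imp_small_values:
  fixes U :: "real \<Rightarrow> real"
  assumes "integrable lebesgue (\<lambda>x. (U x)\<^sup>2)" "e > 0"
  shows "\<exists>y>x. \<bar>U y\<bar> < e"
proof (rule ccontr)
  assume "\<not> ?thesis"
  then have big: "e \<le> \<bar>U y\<bar>" if "y > x" for y using that by force
  let ?I = "LINT x|lebesgue. (U x)\<^sup>2"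
  obtain n :: nat where n: "?I / e\<^sup>2 < n" using reals_Archimedean2 by blast
  have "e\<^sup>2 * n = integral {x+1..x+1+n} (\<lambda>_. e\<^sup>2)" by simp
  also have "\<dots> \<le> integral {x+1..x+1+n} (\<lambda>x. (U x)\<^sup>2)"
  proof (rule integral_le)
    show "(\<lambda>x. (U x)\<^sup>2) integrable_on {x+1..x+1+n}"
      by (intro set_lebesgue_integral_eq_integral(1) integrable_lebesgue_Icc assms)
    fix y assume "y \<in> {x+1..x+1+real n}"
    then have "e \<le> \<bar>U y\<bar>" using big[of y] by auto
    then have "e\<^sup>2 \<le> \<bar>U y\<bar>\<^sup>2" using assms(2) by (intro power_mono) auto
    then show "e\<^sup>2 \<le> (U y)\<^sup>2" by simp
  qed auto
  also have "\<dots> \<le> ?I" by (rule integral_Icc_le_lebesgue[OF assms(1)]) simp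
  finally show False using n assms(2) by (simp add: divide_simps mult.commute)
qed

text \<open>The equation \<open>u'' = (k^2 + V) u\<close> for merely integrable \<open>V\<close>:
  \<open>U\<close> is continuously differentiable, and its derivative \<open>U1\<close> is a
  primitive of the right-hand side, so that the equation holds almost everywhere.\<close>

locale schroedinger_1d =
  fixes k :: real and V U U1 :: "real \<Rightarrow> real"
  assumes V: "integrable lebesgue V" and xV: "integrable lebesgue (\<lambda>x. \<bar>x\<bar> * \<bar>V x\<bar>)"
    and U_deriv: "\<And>x. (U has_real_derivative U1 x) (at x)"
    and U1_primitive: "primitive (\<lambda>x. (k\<^sup>2 + V x) * U x) U1"
begin

lemma U_cont: "continuous_on S U"
  using U_deriv by (meson DERIV_continuous_on has_field_derivative_at_within)

lemma U1_cont: "continuous_on S U1"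
  using U1_primitive by (rule primitive_continuous)

lemma V_Icc: "V absolutely_integrable_on {a..b}"
  by (rule integrable_lebesgue_Icc[OF V])

lemma U1_integral: "(U1 has_integral (U b - U a)) {a..b}" if "a \<le> b"
proof (rule fundamental_theorem_of_calculus[OF that])
  fix x
  show "(U has_vector_derivative U1 x) (at x within {a..b})"
    using has_field_derivative_at_within[OF U_deriv]
    by (simp only: has_real_derivative_iff_has_vector_derivative)
qed

text \<open>Integration by parts against \<open>t - p\<close>, whose derivative is 1. A suitable
  \<open>p\<close> removes the boundary term with \<open>U1\<close> at one end; uniqueness and the
  bound for solutions with a zero both rest on this identity.\<close>

lemma integral_linear_weight:
  assumes "a \<le> b"
  shows "((\<lambda>t. (k\<^sup>2 + V t) * U t * (t - p)) has_integral
    (U1 b * (b - p) - U1 a * (a - p) - (U b - U a))) {a..b}"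
proof -
  have "((\<lambda>t. (k\<^sup>2 + V t) * U t * (t - p) + U1 t * 1) has_integral
    (U1 b * (b - p) - U1 a * (a - p))) {a..b}"
    by (rule primitive_parts[OF U1_primitive assms]) (auto intro!: derivative_eq_intros)
  from has_integral_diff[OF this U1_integral[OF assms]] show ?thesis by simp
qed

section \<open>Unique continuation\<close>

text \<open>Let \<open>x1\<close> maximise \<open>\<bar>U\<bar>\<close> on
  \<open>{p-d..p+d}\<close>. Between \<open>p\<close> and \<open>x1\<close>, the weight
  \<open>t - x1\<close> and the zero data at \<open>p\<close> leave only \<open>U x1\<close> of the
  boundary terms, so \<open>\<bar>U x1\<bar>\<close> is at most itself times \<open>d\<close> times
  an integral of \<open>\<bar>k^2 + V\<bar>\<close>. For small \<open>d\<close> this forces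
  \<open>U x1 = 0\<close>.\<close>

lemma eq_0_near:
  assumes p: "U p = 0" "U1 p = 0"
  shows "\<exists>d>0. \<forall>x. \<bar>x - p\<bar> < d \<longrightarrow> U x = 0 \<and> U1 x = 0"
proof -
  have q: "(\<lambda>t. \<bar>k\<^sup>2 + V t\<bar>) absolutely_integrable_on {a..b}" for a b
    using absolutely_integrable_norm[OF set_integral_add(1)[OF absolutely_integrable_on_const V_Icc]]
    by (simp add: o_def)
  then obtain Q where Q: "primitive (\<lambda>t. \<bar>k\<^sup>2 + V t\<bar>) Q" using primitive_exists[of "\<lambda>t. \<bar>k\<^sup>2 + V t\<bar>"] by blast
  have Q_mono: "Q a \<le> Q b" if "a \<le> b" for a b
    using integral_nonneg[OF primitiveD(3)[OF Q that]] primitiveD(4)[OF Q that] by simp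
  \<comment> \<open>Chosen so that \<open>d\<close> times the integral of
    \<open>\<bar>k^2 + V\<bar>\<close> over \<open>{p-1..p+1}\<close> is below 1; the summand 1
    keeps the denominator positive.\<close>
  define d where "d = 1 / (2 * (1 + (Q (p+1) - Q (p-1))))"
  have pos: "1 + (Q (p+1) - Q (p-1)) > 0" using Q_mono[of "p-1" "p+1"] by simp
  have d: "d > 0" "d \<le> 1" "d * (Q (p+1) - Q (p-1)) < 1"
    using pos Q_mono[of "p-1" "p+1"] by (auto simp: d_def divide_simps)
  obtain x1 where x1: "x1 \<in> {p-d..p+d}" "\<And>y. y \<in> {p-d..p+d} \<Longrightarrow> \<bar>U y\<bar> \<le> \<bar>U x1\<bar>"
    using continuous_attains_sup[OF compact_Icc _ continuous_on_rabs[OF U_cont], of "p-d" "p+d"] d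
    by fastforce
  have key: "\<bar>U x1\<bar> \<le> \<bar>U x1\<bar> * d * (Q (p+1) - Q (p-1))"
    if ab: "p - d \<le> a" "a \<le> b" "b \<le> p + d" "a \<le> x1" "x1 \<le> b" "b - a \<le> d"
      and I: "((\<lambda>t. (k\<^sup>2 + V t) * U t * (t - x1)) has_integral I) {a..b}" and "\<bar>I\<bar> = \<bar>U x1\<bar>" for a b I
  proof -
    have "norm (integral {a..b} (\<lambda>t. (k\<^sup>2 + V t) * U t * (t - x1)))
      \<le> integral {a..b} (\<lambda>t. \<bar>U x1\<bar> * d * \<bar>k\<^sup>2 + V t\<bar>)"
    proof (rule integral_norm_bound_integral)
      show "(\<lambda>t. \<bar>U x1\<bar> * d * \<bar>k\<^sup>2 + V t\<bar>) integrable_on {a..b}"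
        using primitiveD(3)[OF Q ab(2)] by (rule integrable_on_mult_right)
      fix t assume t: "t \<in> {a..b}"
      have "\<bar>k\<^sup>2 + V t\<bar> * (\<bar>U t\<bar> * \<bar>t - x1\<bar>) \<le> \<bar>k\<^sup>2 + V t\<bar> * (\<bar>U x1\<bar> * d)"
        using x1(2)[of t] t ab by (intro mult_left_mono mult_mono) auto
      then show "norm ((k\<^sup>2 + V t) * U t * (t - x1)) \<le> \<bar>U x1\<bar> * d * \<bar>k\<^sup>2 + V t\<bar>"
        by (simp add: abs_mult mult_ac)
    qed (use I in blast)
    also have "\<dots> = \<bar>U x1\<bar> * d * (Q b - Q a)" by (simp add: primitiveD(4)[OF Q ab(2)])
    also have "\<dots> \<le> \<bar>U x1\<bar> * d * (Q (p+1) - Q (p-1))"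
      using Q_mono[of b "p+1"] Q_mono[of "p-1" a] ab d by (intro mult_left_mono) auto
    finally show ?thesis using integral_unique[OF I] \<open>\<bar>I\<bar> = _\<close> by simp
  qed
  have "\<bar>U x1\<bar> \<le> \<bar>U x1\<bar> * d * (Q (p+1) - Q (p-1))"
  proof (cases "x1 \<le> p")
    case True
    then show ?thesis
      using key[of x1 p, OF _ _ _ _ _ _ integral_linear_weight[of x1 p x1]] x1(1) d p by auto
  next
    case False
    then show ?thesis
      using key[of p x1, OF _ _ _ _ _ _ integral_linear_weight[of p x1 x1]] x1(1) d p by auto
  qed
  then have "\<bar>U x1\<bar> * (1 - d * (Q (p+1) - Q (p-1))) \<le> 0" by (simp add: algebra_simps)
  then have "\<bar>U x1\<bar> \<le> 0" using d(3) by (simp add: mult_le_0_iff)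
  then have U0: "U x = 0" if "\<bar>x - p\<bar> < d" for x
    using x1(2)[of x] that by (auto simp: abs_if split: if_splits)
  have "U1 x = 0" if x: "\<bar>x - p\<bar> < d" for x
  proof -
    have "(U has_real_derivative 0) (at x)"
    proof (rule has_field_derivative_transform_within_open)
      show "((\<lambda>_. 0) has_real_derivative 0) (at x)" by simp
      show "open (ball p d)" "x \<in> ball p d" using x by (auto simp: dist_real_def)
    qed (use U0 in \<open>auto simp: dist_real_def abs_minus_commute\<close>)
    then show ?thesis using U_deriv DERIV_unique by blast
  qed
  then show ?thesis using U0 d(1) by blast
qed

text \<open>The common zero set of \<open>U\<close> and \<open>U1\<close> is open by local
  uniqueness, closed by continuity and nonempty, hence the whole line.\<close>

lemma eq_0_everywhere:
  assumes p: "U p = 0" "U1 p = 0"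
  shows "U x = 0"
proof -
  let ?Z = "{x. U x = 0 \<and> U1 x = 0}"
  have "open ?Z"
    unfolding open_dist using eq_0_near by (fastforce simp: dist_real_def)
  moreover have "closed ?Z"
    using U_cont[of UNIV] U1_cont[of UNIV]
    by (intro closed_Collect_conj closed_Collect_eq) auto
  ultimately have "?Z = UNIV" using p connected_clopen[of "UNIV :: real set"] by (auto simp: closedin_def)
  then show ?thesis by auto
qed

section \<open>Solutions with a zero\<close>

text \<open>Between the last zero \<open>p\<close> before a maximum point \<open>x1\<close> of
  \<open>\<bar>u\<bar>\<close> and \<open>x1\<close> itself, \<open>u\<close> has one sign and
  \<open>u'(x1) = 0\<close>. The weight \<open>t - p\<close> then gives
  \<open>m = - \<integral> (k^2 + V) u (t - p)\<close> with \<open>m = u(x1)\<close>. The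
  \<open>k^2\<close> term has a favourable sign, and \<open>0 \<le> t - p \<le> t\<close> because
  \<open>p \<ge> 0\<close>, so that
  \<open>m \<le> m \<integral> \<bar>t\<bar> \<bar>V\<bar>\<close>.\<close>

lemma weighted_bound_of_zero:
  assumes L2: "integrable lebesgue (\<lambda>x. (U x)\<^sup>2)" and nz: "\<exists>x. U x \<noteq> 0"
    and x0: "x0 \<ge> 0" "U x0 = 0"
  shows "1 \<le> (LINT x|lebesgue. \<bar>x\<bar> * \<bar>V x\<bar>)"
proof -
  \<comment> \<open>If \<open>U\<close> vanished to the right of \<open>x0\<close>, so would its
    derivative there, and unique continuation would make \<open>U\<close> zero.\<close>
  have "\<exists>xs>x0. U xs \<noteq> 0"
  proof (rule ccontr)
    assume "\<not> ?thesis"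
    then have U0: "U x = 0" if "x > x0" for x using that by blast
    have "(U has_real_derivative 0) (at (x0 + 1))"
    proof (rule has_field_derivative_transform_within_open)
      show "((\<lambda>_. 0) has_real_derivative 0) (at (x0 + 1))" by simp
      show "open {x0<..}" by simp
    qed (use U0 in auto)
    then have "U1 (x0 + 1) = 0" using U_deriv DERIV_unique by blast
    then show False using eq_0_everywhere[of "x0 + 1"] U0 nz by auto
  qed
  then obtain xs where xs: "xs > x0" "U xs \<noteq> 0" by blast
  \<comment> \<open>A point where \<open>\<bar>U\<bar>\<close> is smaller than at \<open>xs\<close>:
    the maximum over \<open>{x0..Y}\<close> is then attained in the interior.\<close>
  obtain Y where Y: "Y > xs" "\<bar>U Y\<bar> < \<bar>U xs\<bar>"
    using L2_imp_small_values[OF L2, of "\<bar>U xs\<bar>" xs] xs by auto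
  obtain x1 where x1: "x1 \<in> {x0..Y}" "\<And>y. y \<in> {x0..Y} \<Longrightarrow> \<bar>U y\<bar> \<le> \<bar>U x1\<bar>"
    using continuous_attains_sup[OF compact_Icc _ continuous_on_rabs[OF U_cont], of x0 Y] xs Y
    by fastforce
  have x1s: "\<bar>U xs\<bar> \<le> \<bar>U x1\<bar>" using x1(2)[of xs] xs Y by auto
  then have x1': "x0 < x1" "x1 < Y" "U x1 \<noteq> 0"
    using xs Y x0 x1(1) by (auto simp: less_le)
  \<comment> \<open>The sign normalisation makes the value at \<open>x1\<close> a positive
    maximum.\<close>
  define u where "u x = sgn (U x1) * U x" for x
  define m where "m = \<bar>U x1\<bar>"
  have m: "m > 0" "u x1 = m" using x1' by (auto simp: m_def u_def sgn_if)
  have u_le: "\<bar>u x\<bar> \<le> m" if "x \<in> {x0..Y}" for x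
    using x1(2)[OF that] x1' by (simp add: u_def m_def abs_mult abs_sgn_eq)
  have u_cont: "continuous_on S u" for S unfolding u_def by (intro continuous_intros U_cont)
  have "(u has_real_derivative sgn (U x1) * U1 x1) (at x1)"
    unfolding u_def by (rule DERIV_cmult[OF U_deriv])
  moreover have "\<forall>y. \<bar>x1 - y\<bar> < min (x1 - x0) (Y - x1) \<longrightarrow> u y \<le> u x1"
  proof (intro allI impI)
    fix y assume "\<bar>x1 - y\<bar> < min (x1 - x0) (Y - x1)"
    then have "y \<in> {x0..Y}" by (auto simp: abs_less_iff)
    then show "u y \<le> u x1" using u_le[of y] m(2) by simp
  qed
  moreover have "0 < min (x1 - x0) (Y - x1)" using x1' by simp
  ultimately have "sgn (U x1) * U1 x1 = 0" by (metis DERIV_local_max)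
  then have U1x1: "U1 x1 = 0" using x1' by (simp add: sgn_zero_iff)
  have "compact ({x0..x1} \<inter> {t. u t = 0})"
    using u_cont[of UNIV] by (intro compact_Int_closed closed_Collect_eq) auto
  moreover have "x0 \<in> {x0..x1} \<inter> {t. u t = 0}" using x0 x1' by (simp add: u_def)
  ultimately obtain p where p: "p \<in> {x0..x1}" "u p = 0" "\<And>t. t \<in> {x0..x1} \<Longrightarrow> u t = 0 \<Longrightarrow> t \<le> p"
    using compact_attains_sup[of "{x0..x1} \<inter> {t. u t = 0}"] by blast
  \<comment> \<open>A negative value would force a further zero before \<open>x1\<close>, against
    the choice of \<open>p\<close> as the last one.\<close>
  have u_nonneg: "u t \<ge> 0" if "t \<in> {p..x1}" for t
  proof (rule ccontr)
    assume "\<not> u t \<ge> 0"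
    then have "\<exists>r\<ge>t. r \<le> x1 \<and> u r = 0"
      using that m by (intro IVT' u_cont) auto
    then obtain r where "t \<le> r" "r \<le> x1" "u r = 0" by blast
    moreover from this have "r = p" using p(3)[of r] that p(1) by auto
    ultimately show False using that p(2) \<open>\<not> u t \<ge> 0\<close> by auto
  qed
  have Up: "U p = 0" using p(2) x1' by (simp add: u_def sgn_zero_iff)
  have px: "p \<le> x1" using p by simp
  have "((\<lambda>t. (k\<^sup>2 + V t) * U t * (t - p)) has_integral - U x1) {p..x1}"
    using integral_linear_weight[OF px, of p] Up U1x1 by simp
  from has_integral_mult_right[OF this, of "- sgn (U x1)"]
  have "((\<lambda>t. - ((k\<^sup>2 + V t) * u t * (t - p))) has_integral m) {p..x1}"
    using m(2) by (simp add: u_def mult_ac)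
  moreover have "((\<lambda>t. m * (\<bar>t\<bar> * \<bar>V t\<bar>)) has_integral m * integral {p..x1} (\<lambda>t. \<bar>t\<bar> * \<bar>V t\<bar>)) {p..x1}"
    by (intro has_integral_mult_right integrable_integral set_lebesgue_integral_eq_integral(1)
        integrable_lebesgue_Icc xV)
  ultimately have "m \<le> m * integral {p..x1} (\<lambda>t. \<bar>t\<bar> * \<bar>V t\<bar>)"
  proof (rule has_integral_le)
    fix t assume t: "t \<in> {p..x1}"
    have 1: "0 \<le> k\<^sup>2 * (u t * (t - p))" using u_nonneg[OF t] t by simp
    have "- V t * (u t * (t - p)) \<le> \<bar>V t\<bar> * (u t * (t - p))"
      using u_nonneg[OF t] t by (intro mult_right_mono) auto
    also have "\<dots> \<le> \<bar>V t\<bar> * (m * \<bar>t\<bar>)"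
      using u_nonneg[OF t] u_le[of t] t p x0 x1 by (intro mult_left_mono mult_mono) auto
    finally show "- ((k\<^sup>2 + V t) * u t * (t - p)) \<le> m * (\<bar>t\<bar> * \<bar>V t\<bar>)"
      using 1 by (simp add: algebra_simps)
  qed
  then have "1 \<le> integral {p..x1} (\<lambda>t. \<bar>t\<bar> * \<bar>V t\<bar>)" using m by simp
  also have "\<dots> \<le> (LINT x|lebesgue. \<bar>x\<bar> * \<bar>V x\<bar>)"
    by (rule integral_Icc_le_lebesgue[OF xV]) simp
  finally show ?thesis .
qed

section \<open>Positive solutions and the combined bound\<close>

lemma reflect: "schroedinger_1d k (\<lambda>x. V (-x)) (\<lambda>x. U (-x)) (\<lambda>x. - U1 (-x))"
proof
  show "integrable lebesgue (\<lambda>x. V (-x))"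
    by (simp add: lebesgue_integral_reflect_real V)
  show "integrable lebesgue (\<lambda>x. \<bar>x\<bar> * \<bar>V (-x)\<bar>)"
    using lebesgue_integral_reflect_real(2)[of "\<lambda>x. \<bar>x\<bar> * \<bar>V x\<bar>"] xV by simp
  show "((\<lambda>x. U (-x)) has_real_derivative - U1 (-x)) (at x)" for x
    using DERIV_chain2[OF U_deriv[of "-x"] DERIV_minus[OF DERIV_ident]] by simp
  show "primitive (\<lambda>x. (k\<^sup>2 + V (-x)) * U (-x)) (\<lambda>x. - U1 (-x))"
    by (rule primitive_reflect[OF U1_primitive])
qed

text \<open>
  Integrates \<open>u''\<close> against \<open>\<phi>\<^sup>2 / u\<close>; shifting \<open>exp (-k x)\<close> so that \<open>\<phi>\<close> vanishes at \<open>L\<close> makes control of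
  \<open>u' / u\<close> at infinity unnecessary.
\<close>

lemma half_line_bound:
  assumes pos: "\<And>x. U x > 0" and k: "k > 0" and L: "L > 0"
  shows "- (U1 0 / U 0) * (1 - exp (-k * L))\<^sup>2 \<le> integral {0..L} V
    + 2 * k * integral {0..L} (\<lambda>x. \<bar>x\<bar> * \<bar>V x\<bar>) + 2 * exp (-k * L) * integral {0..L} (\<lambda>x. \<bar>V x\<bar>) + k"
proof -
  define \<epsilon> where "\<epsilon> = exp (-k * L)"
  define \<phi> where "\<phi> x = exp (-k * x) - \<epsilon>" for x
  define h where "h x = (\<phi> x)\<^sup>2 / U x" for x
  define h' where "h' x = 2 * \<phi> x * (-k * exp (-k * x)) / U x - (\<phi> x)\<^sup>2 * U1 x / (U x)\<^sup>2" for x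
  have U0: "U x \<noteq> 0" for x using pos[of x] by simp
  have h_deriv: "(h has_real_derivative h' x) (at x within S)" for x S
    unfolding h_def \<phi>_def h'_def using U0[of x]
    by (auto intro!: derivative_eq_intros has_field_derivative_at_within[OF U_deriv]
        simp: power2_eq_square field_simps)
  have h'_cont: "continuous_on S h'" for S
    unfolding h'_def \<phi>_def using U0 by (intro continuous_intros U_cont U1_cont) auto
  have exp_int: "((\<lambda>x. 2 * k\<^sup>2 * exp (-2 * k * x)) has_integral k * (1 - \<epsilon>\<^sup>2)) {0..L}"
  proof -
    have "((\<lambda>x. 2 * k\<^sup>2 * exp (-2 * k * x)) has_integral
      (- k * exp (-2 * k * L) - (- k * exp (-2 * k * 0)))) {0..L}"
      using L by (intro fundamental_theorem_of_calculus)
        (auto intro!: derivative_eq_intros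
          simp: has_real_derivative_iff_has_vector_derivative[symmetric] power2_eq_square)
    moreover have "exp (-2 * k * L) = \<epsilon>\<^sup>2" by (simp add: \<epsilon>_def power2_eq_square flip: exp_add)
    ultimately show ?thesis by (simp add: algebra_simps)
  qed
  have V_int: "(V has_integral integral {0..L} V) {0..L}"
    "((\<lambda>x. \<bar>x\<bar> * \<bar>V x\<bar>) has_integral integral {0..L} (\<lambda>x. \<bar>x\<bar> * \<bar>V x\<bar>)) {0..L}"
    "((\<lambda>x. \<bar>V x\<bar>) has_integral integral {0..L} (\<lambda>x. \<bar>V x\<bar>)) {0..L}"
    by (intro integrable_integral set_lebesgue_integral_eq_integral(1) integrable_lebesgue_Icc
        integrable_abs V xV)+
  have "((\<lambda>x. (k\<^sup>2 + V x) * U x * h x + U1 x * h' x) has_integral (U1 L * h L - U1 0 * h 0)) {0..L}"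
    using L by (intro primitive_parts[OF U1_primitive]) (auto intro: h_deriv h'_cont)
  moreover have "((\<lambda>x. V x + 2 * k * (\<bar>x\<bar> * \<bar>V x\<bar>) + 2 * \<epsilon> * \<bar>V x\<bar> + 2 * k\<^sup>2 * exp (-2 * k * x)) has_integral
    integral {0..L} V + 2 * k * integral {0..L} (\<lambda>x. \<bar>x\<bar> * \<bar>V x\<bar>) + 2 * \<epsilon> * integral {0..L} (\<lambda>x. \<bar>V x\<bar>)
     + k * (1 - \<epsilon>\<^sup>2)) {0..L}"
    by (intro has_integral_add has_integral_mult_right V_int exp_int)
  ultimately have "U1 L * h L - U1 0 * h 0 \<le> integral {0..L} V
    + 2 * k * integral {0..L} (\<lambda>x. \<bar>x\<bar> * \<bar>V x\<bar>) + 2 * \<epsilon> * integral {0..L} (\<lambda>x. \<bar>V x\<bar>) + k * (1 - \<epsilon>\<^sup>2)"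
  proof (rule has_integral_le)
    fix x assume x: "x \<in> {0..L}"
    define E where "E = exp (-k * x)"
    have E: "\<epsilon> \<le> E" "E \<le> 1" "1 - E \<le> k * x"
      using x k exp_ge_add_one_self[of "-k * x"] by (auto simp: E_def \<epsilon>_def)
    have \<epsilon>: "\<epsilon> > 0" by (simp add: \<epsilon>_def)
    have \<phi>: "\<phi> x = E - \<epsilon>" by (simp add: \<phi>_def E_def)
    \<comment> \<open>In terms of the logarithmic derivative \<open>w\<close> the integrand is a
      quadratic polynomial, and completing the square eliminates \<open>w\<close>.\<close>
    define w where "w = U1 x / U x"
    have "(k\<^sup>2 + V x) * U x * h x + U1 x * h' x
      = (k\<^sup>2 + V x) * (\<phi> x)\<^sup>2 + 2 * \<phi> x * (-k * E) * w - (\<phi> x)\<^sup>2 * w\<^sup>2"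
      using U0[of x] by (simp add: h_def h'_def w_def E_def field_simps power2_eq_square)
    also have "\<dots> \<le> (k\<^sup>2 + V x) * (\<phi> x)\<^sup>2 + k\<^sup>2 * E\<^sup>2"
      using zero_le_power2[of "\<phi> x * w + k * E"] by (simp add: power2_eq_square algebra_simps)
    also have "\<dots> \<le> V x * (\<phi> x)\<^sup>2 + 2 * k\<^sup>2 * E\<^sup>2"
    proof -
      have "(\<phi> x)\<^sup>2 \<le> E\<^sup>2" using E \<epsilon> \<phi> by (intro power_mono) auto
      then have "k\<^sup>2 * (\<phi> x)\<^sup>2 \<le> k\<^sup>2 * E\<^sup>2" by (intro mult_left_mono) auto
      then show ?thesis by (simp add: algebra_simps)
    qed
    \<comment> \<open>\<open>V\<close> has no sign, so replacing the weight \<open>\<phi>^2\<close>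
      by 1 costs \<open>\<bar>V\<bar> (1 - \<phi>^2)\<close>. This error is what produces the first
      moment of \<open>\<bar>V\<bar>\<close>, since
      \<open>1 - \<phi> \<le> k x + \<epsilon>\<close>.\<close>
    also have "V x * (\<phi> x)\<^sup>2 \<le> V x + \<bar>V x\<bar> * (1 - (\<phi> x)\<^sup>2)"
    proof -
      have "(\<phi> x)\<^sup>2 \<le> 1" using E \<epsilon> \<phi> by (intro power_le_one) auto
      then have "- V x * (1 - (\<phi> x)\<^sup>2) \<le> \<bar>V x\<bar> * (1 - (\<phi> x)\<^sup>2)" by (intro mult_right_mono) auto
      then show ?thesis by (simp add: algebra_simps)
    qed
    also have "\<bar>V x\<bar> * (1 - (\<phi> x)\<^sup>2) \<le> \<bar>V x\<bar> * (2 * (k * x + \<epsilon>))"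
    proof (rule mult_left_mono)
      have "1 - (\<phi> x)\<^sup>2 = (1 - \<phi> x) * (1 + \<phi> x)" by (simp add: power2_eq_square algebra_simps)
      also have "\<dots> \<le> (k * x + \<epsilon>) * 2" using E \<epsilon> \<phi> by (intro mult_mono) auto
      finally show "1 - (\<phi> x)\<^sup>2 \<le> 2 * (k * x + \<epsilon>)" by simp
    qed simp
    also have "E\<^sup>2 = exp (-2 * k * x)" by (simp add: E_def power2_eq_square flip: exp_add)
    finally show "(k\<^sup>2 + V x) * U x * h x + U1 x * h' x
      \<le> V x + 2 * k * (\<bar>x\<bar> * \<bar>V x\<bar>) + 2 * \<epsilon> * \<bar>V x\<bar> + 2 * k\<^sup>2 * exp (-2 * k * x)"
      using x by (simp add: algebra_simps)
  qed
  moreover have "h L = 0" "h 0 = (1 - \<epsilon>)\<^sup>2 / U 0" by (simp_all add: h_def \<phi>_def \<epsilon>_def)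
  moreover have "k * (1 - \<epsilon>\<^sup>2) \<le> k" using k by (simp add: mult_le_cancel_left2)
  ultimately show ?thesis unfolding \<epsilon>_def by (simp add: algebra_simps)
qed

text \<open>The half-line bounds for the solution and its reflection are added, which cancels
  \<open>u'(0) / u(0)\<close>; then \<open>L\<close> tends to infinity and the terms with
  \<open>exp (-k L)\<close> disappear.\<close>

lemma integral_ge_of_positive:
  assumes pos: "\<And>x. U x > 0" and k: "k > 0"
  shows "0 \<le> (LINT x|lebesgue. V x) + 2 * k * (LINT x|lebesgue. \<bar>x\<bar> * \<bar>V x\<bar>) + 2 * k"
proof -
  interpret R: schroedinger_1d k "\<lambda>x. V (-x)" "\<lambda>x. U (-x)" "\<lambda>x. - U1 (-x)" by (rule reflect)
  let ?A = "\<lambda>L. integral {-L..L} V" and ?M = "LINT x|lebesgue. \<bar>x\<bar> * \<bar>V x\<bar>"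
    and ?N = "LINT x|lebesgue. \<bar>V x\<bar>"
  have aV: "integrable lebesgue (\<lambda>x. \<bar>V x\<bar>)" using V by (rule integrable_abs)
  have split: "integral {0..L} f + integral {0..L} (\<lambda>x. f (-x)) = integral {-L..L} f"
    if "L > 0" "integrable lebesgue f" for L and f :: "real \<Rightarrow> real"
  proof -
    have "integral {0..L} (\<lambda>x. f (-x)) = integral {-L..0} f"
      using Henstock_Kurzweil_Integration.integral_reflect_real[of 0 "-L" f] by simp
    then show ?thesis
      using Henstock_Kurzweil_Integration.integral_combine[of "-L" 0 L f] that
        set_lebesgue_integral_eq_integral(1)[OF integrable_lebesgue_Icc[OF that(2), of "-L" L]] by simp
  qed
  have bound: "0 \<le> ?A L + 2 * k * ?M + 2 * exp (-k * L) * ?N + 2 * k" if L: "L > 0" for L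
  proof -
    have "integral {-L..L} (\<lambda>x. \<bar>x\<bar> * \<bar>V x\<bar>) \<le> ?M"
      by (rule integral_Icc_le_lebesgue[OF xV]) simp
    then have "2 * k * integral {-L..L} (\<lambda>x. \<bar>x\<bar> * \<bar>V x\<bar>) \<le> 2 * k * ?M"
      using k by simp
    moreover have "integral {-L..L} (\<lambda>x. \<bar>V x\<bar>) \<le> ?N"
      by (rule integral_Icc_le_lebesgue[OF aV]) simp
    then have "2 * exp (-k * L) * integral {-L..L} (\<lambda>x. \<bar>V x\<bar>) \<le> 2 * exp (-k * L) * ?N"
      by simp
    \<comment> \<open>Reflection changes the sign of the derivative at 0, so the two boundary terms
      are opposite.\<close>
    moreover have "- (U1 0 / U 0) * (1 - exp (-k * L))\<^sup>2 = - (- (- U1 (-0) / U (-0)) * (1 - exp (-k * L))\<^sup>2)"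
      by simp
    ultimately show ?thesis
      using half_line_bound[OF pos k L] R.half_line_bound[OF pos k L]
      unfolding split[OF L V, symmetric] split[OF L xV, symmetric] split[OF L aV, symmetric] abs_minus_cancel distrib_left
      by linarith
  qed
  \<comment> \<open>Dominated convergence with majorant \<open>\<bar>V\<bar>\<close>.\<close>
  have "(\<lambda>n. integral UNIV (\<lambda>x. if x \<in> {-real n..real n} then V x else 0)) \<longlonglongrightarrow> integral UNIV V"
  proof (rule dominated_convergence(2))
    show "(\<lambda>x. if x \<in> {-real n..real n} then V x else 0) integrable_on UNIV" for n
      using set_lebesgue_integral_eq_integral(1)[OF V_Icc] integrable_restrict_UNIV by blast
    show "(\<lambda>x. \<bar>V x\<bar>) integrable_on UNIV" using aV by (rule integrable_on_lebesgue)
    fix x :: real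
    have "\<forall>\<^sub>F n in sequentially. \<bar>x\<bar> \<le> real n" by real_asymp
    then have "\<forall>\<^sub>F n in sequentially. (if x \<in> {-real n..real n} then V x else 0) = V x"
      by eventually_elim auto
    then show "(\<lambda>n. if x \<in> {-real n..real n} then V x else 0) \<longlonglongrightarrow> V x"
      by (rule tendsto_eventually)
  qed auto
  then have A: "(\<lambda>n. ?A (real n)) \<longlonglongrightarrow> (LINT x|lebesgue. V x)"
    by (simp only: integral_restrict_UNIV integral_lebesgue[OF V])
  have "(\<lambda>n. exp (-k * real n)) \<longlonglongrightarrow> 0" using k by real_asymp
  then have "(\<lambda>n. 2 * exp (-k * real n) * ?N) \<longlonglongrightarrow> 2 * 0 * ?N" by (intro tendsto_intros)
  then have "(\<lambda>n. ?A (real n) + 2 * k * ?M + 2 * exp (-k * real n) * ?N + 2 * k)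
     \<longlonglongrightarrow> (LINT x|lebesgue. V x) + 2 * k * ?M + 2 * 0 * ?N + 2 * k"
    by (intro tendsto_add A tendsto_const)
  then have "0 \<le> (LINT x|lebesgue. V x) + 2 * k * ?M + 2 * 0 * ?N + 2 * k"
  proof (rule tendsto_lowerbound)
    show "\<forall>\<^sub>F n in sequentially. 0 \<le> ?A (real n) + 2 * k * ?M + 2 * exp (-k * real n) * ?N + 2 * k"
      using eventually_gt_at_top[of 0] by eventually_elim (rule bound, simp)
  qed auto
  then show ?thesis by simp
qed

lemma uminus: "schroedinger_1d k V (\<lambda>x. - U x) (\<lambda>x. - U1 x)"
proof
  show "((\<lambda>x. - U x) has_real_derivative - U1 x) (at x)" for x
    by (rule DERIV_minus[OF U_deriv])
  have "((\<lambda>t. (k\<^sup>2 + V t) * - U t) has_integral - U1 y - - U1 x) {x..y}" if "x \<le> y" for x y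
    using has_integral_neg[OF primitiveD(2)[OF U1_primitive that]] by (simp add: algebra_simps)
  moreover have "(\<lambda>t. (k\<^sup>2 + V t) * - U t) absolutely_integrable_on {x..y}" if "x \<le> y" for x y
    using absolutely_integrable_scaleR_left[OF primitiveD(1)[OF U1_primitive that], of "-1"]
    by (simp add: algebra_simps)
  ultimately show "primitive (\<lambda>x. (k\<^sup>2 + V x) * - U x) (\<lambda>x. - U1 x)"
    by (simp add: primitive_def)
qed (rule V xV)+

text \<open>A zero on the negative half line is moved to the positive one by reflection. Without
  zeros, continuity fixes the sign of \<open>U\<close>, and passing to \<open>-U\<close> if
  necessary makes it positive.\<close>

theorem weighted_bound:
  assumes L2: "integrable lebesgue (\<lambda>x. (U x)\<^sup>2)" and nz: "\<exists>x. U x \<noteq> 0"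
    and k: "k > 0" and less: "(LINT x|lebesgue. V x) < - 4 * k"
  shows "1 \<le> (LINT x|lebesgue. \<bar>x\<bar> * \<bar>V x\<bar>)"
proof (cases "\<exists>x. U x = 0")
  case True
  then obtain x0 where x0: "U x0 = 0" by blast
  show ?thesis
  proof (cases "x0 \<ge> 0")
    case True
    then show ?thesis using weighted_bound_of_zero[OF L2 nz] x0 by blast
  next
    case False
    interpret R: schroedinger_1d k "\<lambda>x. V (-x)" "\<lambda>x. U (-x)" "\<lambda>x. - U1 (-x)" by (rule reflect)
    have "1 \<le> (LINT x|lebesgue. \<bar>x\<bar> * \<bar>V (-x)\<bar>)"
    proof (rule R.weighted_bound_of_zero)
      show "integrable lebesgue (\<lambda>x. (U (-x))\<^sup>2)"
        using lebesgue_integral_reflect_real(2)[of "\<lambda>x. (U x)\<^sup>2"] L2 by simp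
      show "\<exists>x. U (-x) \<noteq> 0" using nz by (metis minus_minus)
      show "U (- (- x0)) = 0" "- x0 \<ge> 0" using x0 False by auto
    qed
    then show ?thesis using lebesgue_integral_reflect_real(1)[of "\<lambda>x. \<bar>x\<bar> * \<bar>V x\<bar>"] by simp
  qed
next
  case False
  have "(\<forall>x. U x > 0) \<or> (\<forall>x. U x < 0)"
  proof (rule ccontr)
    assume "\<not> ?thesis"
    then obtain a b where "U a < 0" "U b > 0" using False by (metis linorder_neqE)
    then have "connected (range U)" "U a \<in> range U" "U b \<in> range U"
      by (auto intro!: connected_continuous_image U_cont)
    then have "0 \<in> range U" using connectedD_interval[of "range U" "U a" "U b" 0] \<open>U a < 0\<close> \<open>U b > 0\<close> by auto
    then show False using False by auto
  qed
  then have "0 \<le> (LINT x|lebesgue. V x) + 2 * k * (LINT x|lebesgue. \<bar>x\<bar> * \<bar>V x\<bar>) + 2 * k"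
  proof
    assume "\<forall>x. U x > 0"
    then show ?thesis using integral_ge_of_positive k by blast
  next
    assume neg: "\<forall>x. U x < 0"
    interpret N: schroedinger_1d k V "\<lambda>x. - U x" "\<lambda>x. - U1 x" by (rule uminus)
    show ?thesis using N.integral_ge_of_positive k neg by simp
  qed
  \<comment> \<open>Inserting \<open>\<integral> V < -4k\<close> leaves
    \<open>-2k + 2k \<integral> \<bar>x\<bar> \<bar>V\<bar> > 0\<close>.\<close>
  then have "2 * k * 1 \<le> 2 * k * (LINT x|lebesgue. \<bar>x\<bar> * \<bar>V x\<bar>)" using less by simp
  then show ?thesis using k by (simp only: mult_le_cancel_left_pos)
qed

end

subsection \<open>Weak derivatives\<close>

lemma bump_support: "{x. bump a b n x \<noteq> 0} \<subseteq> {a..b}"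
proof
  fix x assume "x \<in> {x. bump a b n x \<noteq> 0}"
  then have "x \<in> {a<..<b}" using bump_outside by blast
  then show "x \<in> {a..b}" by simp
qed

lemma integrable_lebesgue_compact_support:
  fixes f :: "real \<Rightarrow> real"
  assumes "f absolutely_integrable_on {a..b}" "{x. f x \<noteq> 0} \<subseteq> {a..b}"
  shows "integrable lebesgue f" "(LINT x|lebesgue. f x) = integral {a..b} f"
proof -
  have eq: "(\<lambda>x. indicat_real {a..b} x *\<^sub>R f x) = f"
    using assms(2) by (intro ext) (force simp: indicator_def)
  show "integrable lebesgue f" using assms(1) unfolding set_integrable_def eq .
  show "(LINT x|lebesgue. f x) = integral {a..b} f"
    using set_lebesgue_integral_eq_integral(2)[OF assms(1)] unfolding set_lebesgue_integral_def eq .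
qed

text \<open>Closed intervals form an intersection-stable generator of the Borel sets, so the
  integral vanishes over every Borel set, and then over every Lebesgue set. A function with this
  property is 0 almost everywhere.\<close>

lemma AE_eq_0_of_integral_Icc_eq_0:
  fixes g :: "real \<Rightarrow> real"
  assumes g: "\<And>a b. g absolutely_integrable_on {a..b}" and 0: "\<And>a b. integral {a..b} g = 0"
  shows "AE x in lebesgue. g x = 0"
proof -
  \<comment> \<open>Since \<open>g\<close> is only locally integrable, it is first cut off to
    \<open>{-n..n}\<close>.\<close>
  have "AE x in lebesgue. indicator {-real n..real n} x * g x = 0" for n
  proof (rule density_unique_real)
    let ?g = "\<lambda>x. indicator {-real n..real n} x * g x"
    show int: "integrable lebesgue ?g"
      using g[of "-real n" "real n"] by (simp add: set_integrable_def)
    show "integrable lebesgue (\<lambda>_::real. 0 :: real)" by simp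
    have set_int: "set_integrable lebesgue A ?g" if "A \<in> sets lebesgue" for A
      using that int unfolding set_integrable_def by (rule integrable_mult_indicator)
    have Icc: "(LINT x:{a..b}|lebesgue. ?g x) = 0" for a b
    proof -
      have "(LINT x:{a..b}|lebesgue. ?g x) = (LINT x:{max a (-real n)..min b (real n)}|lebesgue. g x)"
        unfolding set_lebesgue_integral_def
        by (rule Bochner_Integration.integral_cong) (auto simp: indicator_def)
      then show ?thesis by (simp add: set_lebesgue_integral_eq_integral(2)[OF g] 0)
    qed
    have borel: "(LINT x:A|lebesgue. ?g x) = 0" if "A \<in> sets borel" for A
    proof -
      let ?G = "range (\<lambda>(a, b). {a..b::real})"
      have sigma: "A \<in> sets borel \<longleftrightarrow> A \<in> sigma_sets UNIV ?G" for A
        unfolding borel_eq_atLeastAtMost by simp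
      have leb: "A \<in> sets lebesgue" if "A \<in> sigma_sets UNIV ?G" for A
        using that unfolding sigma[symmetric] by simp
      have "Int_stable ?G" by (auto simp: Int_stable_def)
      moreover have "?G \<subseteq> Pow UNIV" by simp
      moreover have "A \<in> sigma_sets UNIV ?G" using that unfolding sigma .
      ultimately show ?thesis
      proof (induction A rule: sigma_sets_induct_disjoint)
        case (basic A)
        then show ?case using Icc by auto
      next
        case empty
        show ?case by (simp add: set_lebesgue_integral_def)
      next
        case (compl A)
        then have A: "A \<in> sets lebesgue" by (intro leb)
        have "(LINT x:UNIV - A \<union> A|lebesgue. ?g x) = (LINT x:UNIV - A|lebesgue. ?g x) + (LINT x:A|lebesgue. ?g x)"
          using A by (intro set_integral_Un set_int) auto
        moreover have "(LINT x:UNIV - A \<union> A|lebesgue. ?g x) = (LINT x:{-real n..real n}|lebesgue. ?g x)"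
          unfolding set_lebesgue_integral_def
          by (rule Bochner_Integration.integral_cong) (auto simp: indicator_def)
        ultimately show ?case using compl.IH Icc by simp
      next
        case (union A)
        then have A: "A i \<in> sets lebesgue" for i by (intro leb) auto
        have "(LINT x:(\<Union>i. A i)|lebesgue. ?g x) = (\<Sum>i. (LINT x:A i|lebesgue. ?g x))"
          using union(1) A by (intro lebesgue_integral_countable_add set_int)
            (auto simp: disjoint_family_on_def)
        then show ?case using union.IH by simp
      qed
    qed
    \<comment> \<open>A Lebesgue set differs from an F-sigma set, which is Borel, by a null
      set.\<close>
    fix A :: "real set" assume "A \<in> sets lebesgue"
    then obtain C T where CT: "fsigma C" "T \<in> null_sets lebesgue" "C \<union> T = A" "disjnt C T"
      by (rule lebesgue_set_almost_fsigma)
    have C: "C \<in> sets borel" using CT(1) by (auto elim!: fsigma.cases)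
    have "(LINT x:A|lebesgue. ?g x) = (LINT x:C|lebesgue. ?g x)"
      unfolding set_lebesgue_integral_def
    proof (rule integral_cong_AE)
      show "AE x in lebesgue. indicat_real A x *\<^sub>R ?g x = indicat_real C x *\<^sub>R ?g x"
        using AE_not_in[OF CT(2)] by eventually_elim (use CT(3) in \<open>auto simp: indicator_def\<close>)
    qed (use set_int[of A] set_int[of C] \<open>A \<in> sets lebesgue\<close> C in \<open>auto simp: set_integrable_def\<close>)
    then show "(LINT x:A|lebesgue. ?g x) = (LINT x:A|lebesgue. 0)"
      using borel[OF C] by (simp add: set_lebesgue_integral_def)
  qed
  then have "AE x in lebesgue. \<forall>n. indicator {-real n..real n} x * g x = 0"
    unfolding AE_all_countable by blast
  then show ?thesis
  proof eventually_elim
    case (elim x)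
    obtain n :: nat where "\<bar>x\<bar> \<le> real n" using real_arch_simple by blast
    then show ?case using elim[rule_format, of n] by (auto simp: indicator_def split: if_splits)
  qed
qed

section \<open>Test functions and the du Bois-Reymond lemma\<close>

lemma test_functionsI:
  assumes "smooth f" "{x. f x \<noteq> 0} \<subseteq> {a..b}"
  shows "f \<in> test_functions"
proof -
  have "closure {x. f x \<noteq> 0} \<subseteq> {a..b}"
    by (rule closure_minimal) (use assms(2) in simp_all)
  then have "compact (closure {x. f x \<noteq> 0})"
    by (meson bounded_subset closed_closure compact_Icc compact_eq_bounded_closed)
  then show ?thesis using assms(1) by (simp add: test_functions_def smooth_def)
qed

lemma test_functionsE:
  assumes "\<phi> \<in> test_functions"
  obtains R where "R > 0" "smooth \<phi>" "\<And>x. x \<notin> {-R<..<R} \<Longrightarrow> \<phi> x = 0 \<and> deriv \<phi> x = 0"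
proof -
  have sm: "smooth \<phi>" and "compact (closure {x. \<phi> x \<noteq> 0})"
    using assms by (auto simp: test_functions_def smooth_def)
  then have "bounded {x. \<phi> x \<noteq> 0}" by (meson bounded_subset closure_subset compact_imp_bounded)
  then obtain B where B: "B > 0" "\<And>x. \<phi> x \<noteq> 0 \<Longrightarrow> \<bar>x\<bar> \<le> B"
    unfolding bounded_pos by auto
  then have out: "\<phi> x = 0" if "\<bar>x\<bar> > B" for x using that by (meson not_less)
  have "deriv \<phi> x = 0" if "\<bar>x\<bar> > B" for x
  proof (rule DERIV_imp_deriv, rule has_field_derivative_transform_within_open)
    show "((\<lambda>_. 0) has_real_derivative 0) (at x)" by simp
    show "open {y::real. B < \<bar>y\<bar>}" by (intro open_Collect_less continuous_intros)
    show "x \<in> {y. B < \<bar>y\<bar>}" using that by simp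
    show "0 = \<phi> y" if "y \<in> {y. B < \<bar>y\<bar>}" for y using that out by simp
  qed
  \<comment> \<open>The radius is enlarged by 1 so that the function and its derivative vanish at
    the end points too.\<close>
  moreover have "\<bar>x\<bar> > B" if "x \<notin> {-(B+1)<..<B+1}" for x using that by auto
  ultimately show thesis
    using B(1) out by (intro that[of "B + 1"] sm) simp_all
qed

lemma integrable_mult_smooth:
  fixes g :: "real \<Rightarrow> real"
  assumes "\<And>a b. g absolutely_integrable_on {a..b}" "smooth f" "{x. f x \<noteq> 0} \<subseteq> {a..b}"
  shows "integrable lebesgue (\<lambda>x. f x * g x)" "(LINT x|lebesgue. f x * g x) = integral {a..b} (\<lambda>x. f x * g x)"
proof -
  have "(\<lambda>x. f x * g x) absolutely_integrable_on {a..b}"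
    using absolutely_integrable_mult_continuous[OF assms(1) smooth_continuous[OF assms(2)]]
    by (simp add: mult.commute)
  note * = integrable_lebesgue_compact_support[OF this]
  show "integrable lebesgue (\<lambda>x. f x * g x)" "(LINT x|lebesgue. f x * g x) = integral {a..b} (\<lambda>x. f x * g x)"
    by (rule *, use assms(3) in auto)+
qed

text \<open>The primitive that vanishes at \<open>a\<close> is 0 to the left of the support, and to
  its right it equals the total integral, which is 0.\<close>

lemma test_function_primitive:
  assumes sm: "smooth f" and supp: "{x. f x \<noteq> 0} \<subseteq> {a..b}" and 0: "(LINT x|lebesgue. f x) = 0"
  shows "\<exists>\<phi>\<in>test_functions. deriv \<phi> = f"
proof -
  have "f absolutely_integrable_on {x..y}" for x y
    by (intro absolutely_integrable_continuous_real smooth_continuous sm)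
  then obtain P where P: "primitive f P" using primitive_exists by blast
  have deriv: "((\<lambda>x. P x - P a) has_real_derivative f x) (at x)" for x
  proof -
    have "isCont f x" for x
      using smooth_continuous[OF sm, of UNIV] by (simp add: continuous_on_eq_continuous_at)
    then have "(P has_real_derivative f x) (at x)" by (rule primitive_has_derivative[OF P])
    from DERIV_diff[OF this DERIV_const[of "P a"]] show ?thesis by simp
  qed
  have "P x - P a = 0" if x: "x \<notin> {a..b}" for x
  proof (cases "x < a")
    case True
    have "integral {x..a} f = integral {x..a} (\<lambda>_. 0)"
      by (rule integral_spike[of "{a}"]) (use supp in auto)
    then show ?thesis using primitiveD(4)[OF P, of x a] True by simp
  next
    case False
    then have "a \<le> x" by simp
    have "integral {a..x} f = (LINT x|lebesgue. f x)"
      by (rule integrable_lebesgue_compact_support(2)[symmetric])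
        (use supp x False in \<open>auto intro!: absolutely_integrable_continuous_real smooth_continuous sm\<close>)
    then show ?thesis using primitiveD(4)[OF P \<open>a \<le> x\<close>] 0 by simp
  qed
  then have "(\<lambda>x. P x - P a) \<in> test_functions"
    by (intro test_functionsI[OF smoothI[OF deriv sm], of a b]) blast
  moreover have "deriv (\<lambda>x. P x - P a) = f" using deriv by (intro ext DERIV_imp_deriv)
  ultimately show ?thesis by blast
qed

text \<open>Subtracting from \<open>f\<close> a multiple of a fixed bump \<open>b0\<close> gives
  mean zero, hence the derivative of a test function, on which \<open>g\<close> vanishes by
  hypothesis. So \<open>\<integral> f g = c \<integral> f\<close> for every smooth \<open>f\<close>
  with compact support, and bumps tending to an indicator function give
  \<open>\<integral> (g - c) = 0\<close> over every interval.\<close>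

lemma du_Bois_Reymond:
  fixes g :: "real \<Rightarrow> real"
  assumes g: "\<And>a b. g absolutely_integrable_on {a..b}"
    and 0: "\<And>\<phi>. \<phi> \<in> test_functions \<Longrightarrow> (LINT x|lebesgue. deriv \<phi> x * g x) = 0"
  shows "\<exists>c. AE x in lebesgue. g x = c"
proof -
  let ?I = "\<lambda>f. LINT x|lebesgue. f x * g x" and ?J = "\<lambda>f. LINT x|lebesgue. f x :: real"
  define b0 where "b0 = bump 0 1 0"
  have b0: "smooth b0" "{x. b0 x \<noteq> 0} \<subseteq> {0..1}"
    by (simp_all only: b0_def smooth_bump bump_support)
  have const: "(\<lambda>_. c::real) absolutely_integrable_on {a..b}" for a b c :: real
    by (intro absolutely_integrable_continuous_real continuous_intros)
  have J_int: "integrable lebesgue f" if "smooth f" "{x. f x \<noteq> 0} \<subseteq> {a..b}" for f a b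
    using integrable_mult_smooth(1)[OF const[of _ _ 1] that] by simp
  have "?J b0 \<noteq> 0"
  proof
    assume "?J b0 = 0"
    then have "AE x in lebesgue. b0 x = 0"
      using integral_nonneg_eq_0_iff_AE[OF J_int[OF b0]] by (simp add: b0_def bump_bounds)
    then have "AE x in lebesgue. x \<notin> {0<..<1::real}"
    proof eventually_elim
      case (elim x)
      then show ?case using bump_pos[of x 0 1 0] unfolding b0_def by fastforce
    qed
    then have "{0<..<1::real} \<in> null_sets lebesgue"
      by (subst AE_iff_null_sets) auto
    then show False by (simp add: null_sets_def)
  qed
  define c where "c = ?I b0 / ?J b0"
  have key: "?I f = c * ?J f" if sm: "smooth f" and supp: "{x. f x \<noteq> 0} \<subseteq> {a..b}" for f a b
  proof -
    define h where "h x = f x + - (?J f / ?J b0) * b0 x" for x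
    have h: "smooth h" unfolding h_def by (intro smooth_add smooth_mult smooth_const sm b0)
    have "?J h = ?J f - (?J f / ?J b0) * ?J b0"
      unfolding h_def using J_int[OF sm supp] J_int[OF b0] by simp
    then have "?J h = 0" using \<open>?J b0 \<noteq> 0\<close> by simp
    moreover have "{x. h x \<noteq> 0} \<subseteq> {min a 0..max b 1}"
    proof
      fix x assume "x \<in> {x. h x \<noteq> 0}"
      then have "f x \<noteq> 0 \<or> b0 x \<noteq> 0" by (auto simp: h_def)
      then have "x \<in> {a..b} \<or> x \<in> {0..1}" using supp b0(2) by blast
      then show "x \<in> {min a 0..max b 1}" by auto
    qed
    ultimately obtain \<phi> where "\<phi> \<in> test_functions" "deriv \<phi> = h"
      using test_function_primitive[OF h] by metis
    then have "?I h = 0" using 0 by blast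
    moreover have "?I h = ?I f - (?J f / ?J b0) * ?I b0"
    proof -
      have "h x * g x = f x * g x - (?J f / ?J b0) * (b0 x * g x)" for x
        by (simp add: h_def algebra_simps)
      then show ?thesis
        using integrable_mult_smooth(1)[OF g sm supp] integrable_mult_smooth(1)[OF g b0] by simp
    qed
    ultimately show ?thesis by (simp add: c_def)
  qed
  have gc: "(\<lambda>x. g x - c) absolutely_integrable_on {a..b}" for a b
    by (intro set_integral_diff g const)
  have "integral {a..b} (\<lambda>x. g x - c) = 0" for a b
  proof -
    have gco: "(\<lambda>x. g x - c) absolutely_integrable_on {a<..<b}"
      by (rule set_integrable_subset[OF gc[of a b]]) auto
    have "(LINT x|lebesgue. bump a b n x * (g x - c)) = 0" for n
      using key[OF smooth_bump bump_support] integrable_mult_smooth(1)[OF g smooth_bump bump_support]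
        J_int[OF smooth_bump bump_support]
      by (simp add: right_diff_distrib)
    moreover have "(\<lambda>n. LINT x|lebesgue. bump a b n x * (g x - c))
      \<longlonglongrightarrow> (LINT x|lebesgue. indicator {a<..<b} x * (g x - c))"
    proof (rule integral_dominated_convergence)
      show "integrable lebesgue (\<lambda>x. indicator {a..b} x * \<bar>g x - c\<bar>)"
        using absolutely_integrable_norm[OF gc, of a b] by (simp add: o_def set_integrable_def)
      show "(\<lambda>x. indicat_real {a<..<b} x * (g x - c)) \<in> borel_measurable lebesgue"
        using gco unfolding set_integrable_def real_scaleR_def by (rule borel_measurable_integrable)
      show "(\<lambda>x. bump a b n x * (g x - c)) \<in> borel_measurable lebesgue" for n
        using integrable_mult_smooth(1)[OF gc smooth_bump bump_support] by blast
      show "AE x in lebesgue. (\<lambda>n. bump a b n x * (g x - c)) \<longlonglongrightarrow> indicator {a<..<b} x * (g x - c)"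
        by (intro always_eventually allI tendsto_intros bump_limit)
      show "AE x in lebesgue. norm (bump a b n x * (g x - c)) \<le> indicator {a..b} x * \<bar>g x - c\<bar>" for n
      proof (intro always_eventually allI)
        fix x
        show "norm (bump a b n x * (g x - c)) \<le> indicator {a..b} x * \<bar>g x - c\<bar>"
        proof (cases "x \<in> {a..b}")
          case True
          have "\<bar>bump a b n x\<bar> * \<bar>g x - c\<bar> \<le> 1 * \<bar>g x - c\<bar>"
            using bump_bounds[of a b n x] by (intro mult_right_mono) auto
          then show ?thesis using True by (simp add: abs_mult)
        next
          case False
          then have "bump a b n x = 0" by (intro bump_outside) auto
          then show ?thesis by simp
        qed
      qed
    qed
    ultimately have "(LINT x|lebesgue. indicator {a<..<b} x * (g x - c)) = 0"
      by (simp add: LIMSEQ_const_iff)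
    moreover have "(LINT x|lebesgue. indicator {a<..<b} x * (g x - c)) = integral {a<..<b} (\<lambda>x. g x - c)"
      using set_lebesgue_integral_eq_integral(2)[OF gco] by (simp add: set_lebesgue_integral_def)
    ultimately show ?thesis by (simp add: integral_open_interval_real)
  qed
  then have "AE x in lebesgue. g x - c = 0" by (rule AE_eq_0_of_integral_Icc_eq_0[OF gc])
  then show ?thesis by auto
qed

text \<open>A primitive \<open>W\<close> of \<open>v\<close> has weak derivative \<open>v\<close> by
  integration by parts. Hence \<open>u - W\<close> has weak derivative 0 and is constant almost
  everywhere; the constant is absorbed into \<open>U\<close>.\<close>

lemma weak_deriv_imp_primitive:
  fixes u v :: "real \<Rightarrow> real"
  assumes u: "\<And>a b. u absolutely_integrable_on {a..b}" and v: "\<And>a b. v absolutely_integrable_on {a..b}"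
    and weak: "\<And>\<phi>. \<phi> \<in> test_functions \<Longrightarrow>
      (LINT x|lebesgue. deriv \<phi> x * u x) = - (LINT x|lebesgue. \<phi> x * v x)"
  shows "\<exists>U. primitive v U \<and> (AE x in lebesgue. u x = U x)"
proof -
  obtain W where W: "primitive v W" using primitive_exists[OF v] by blast
  have Wi: "W absolutely_integrable_on {a..b}" for a b
    by (intro absolutely_integrable_continuous_real primitive_continuous[OF W])
  have "\<exists>c. AE x in lebesgue. u x - W x = c"
  proof (rule du_Bois_Reymond)
    show "(\<lambda>x. u x - W x) absolutely_integrable_on {a..b}" for a b
      by (intro set_integral_diff u Wi)
    fix \<phi> assume \<phi>: "\<phi> \<in> test_functions"
    then obtain R where R: "R > 0" "smooth \<phi>" "\<And>x. x \<notin> {-R<..<R} \<Longrightarrow> \<phi> x = 0 \<and> deriv \<phi> x = 0"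
      by (elim test_functionsE) (rule that)
    have R': "{x. \<phi> x \<noteq> 0} \<subseteq> {-R..R}" "{x. deriv \<phi> x \<noteq> 0} \<subseteq> {-R..R}"
    proof -
      have "x \<in> {-R<..<R}" if "\<phi> x \<noteq> 0 \<or> deriv \<phi> x \<noteq> 0" for x using R(3) that by blast
      then show "{x. \<phi> x \<noteq> 0} \<subseteq> {-R..R}" "{x. deriv \<phi> x \<noteq> 0} \<subseteq> {-R..R}" by fastforce+
    qed
    note i = integrable_mult_smooth[OF v R(2) R'(1)] integrable_mult_smooth[OF Wi smooth_deriv[OF R(2)] R'(2)]
      integrable_mult_smooth[OF u smooth_deriv[OF R(2)] R'(2)]
    have "((\<lambda>x. v x * \<phi> x + W x * deriv \<phi> x) has_integral (W R * \<phi> R - W (-R) * \<phi> (-R))) {-R..R}"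
    proof (rule primitive_parts[OF W])
      show "(\<phi> has_real_derivative deriv \<phi> x) (at x within {-R..R})" for x
        by (rule has_field_derivative_at_within[OF smooth_has_derivative[OF R(2)]])
      show "continuous_on {-R..R} (deriv \<phi>)" by (rule smooth_continuous[OF smooth_deriv[OF R(2)]])
    qed (use R(1) in simp)
    moreover have "\<phi> R = 0" "\<phi> (-R) = 0" using R(3)[of R] R(3)[of "-R"] by auto
    ultimately have "integral {-R..R} (\<lambda>x. v x * \<phi> x + W x * deriv \<phi> x) = 0"
      by (simp add: integral_unique)
    moreover have "(\<lambda>x. \<phi> x * v x) integrable_on {-R..R}" "(\<lambda>x. deriv \<phi> x * W x) integrable_on {-R..R}"
      using integrable_lebesgue_Icc[OF i(1)] integrable_lebesgue_Icc[OF i(3)]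
      by (auto intro: set_lebesgue_integral_eq_integral(1))
    ultimately have "(LINT x|lebesgue. \<phi> x * v x) + (LINT x|lebesgue. deriv \<phi> x * W x) = 0"
      unfolding i(2) i(4) by (simp add: mult.commute integral_add)
    then show "(LINT x|lebesgue. deriv \<phi> x * (u x - W x)) = 0"
      using weak[OF \<phi>] i(3,5) by (simp add: right_diff_distrib)
  qed
  then obtain c where c: "AE x in lebesgue. u x - W x = c" by blast
  have "primitive v (\<lambda>x. W x + c)" using W by (simp add: primitive_def)
  moreover have "AE x in lebesgue. u x = W x + c" using c by eventually_elim simp
  ultimately show ?thesis by blast
qed

subsection \<open>Eigenfunctions\<close>

text \<open>Here and below, \<open>r\<close> stands for \<open>Re\<close> or \<open>Im\<close>, so
  that both components are treated at once.\<close>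

lemma L_1_loc_component:
  assumes "u \<in> L_1_loc" and r: "bounded_linear (r :: complex \<Rightarrow> real)"
  shows "(\<lambda>x. r (u x)) absolutely_integrable_on {a..b}"
proof -
  have "u absolutely_integrable_on {a..b}" using assms(1) by (simp add: L_1_loc_def)
  from absolutely_integrable_linear[OF this r] show ?thesis by (simp add: o_def)
qed

lemma integrable_test_scaleR:
  fixes u :: "real \<Rightarrow> complex"
  assumes u: "u \<in> L_1_loc" and f: "smooth f" and supp: "{x. f x \<noteq> 0} \<subseteq> {a..b}"
  shows "integrable lebesgue (\<lambda>x. f x *\<^sub>R u x)"
proof -
  have "integrable lebesgue (\<lambda>x. f x * r (u x))" if "bounded_linear r" for r :: "complex \<Rightarrow> real"
    by (rule integrable_mult_smooth(1)[OF L_1_loc_component[OF u that] f supp])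
  from this[OF bounded_linear_Re] this[OF bounded_linear_Im]
  have "integrable lebesgue (\<lambda>x. complex_of_real (f x * Re (u x)) + \<i> * complex_of_real (f x * Im (u x)))"
    by (intro Bochner_Integration.integrable_add integrable_mult_right integrable_of_real)
  also have "(\<lambda>x. complex_of_real (f x * Re (u x)) + \<i> * complex_of_real (f x * Im (u x))) = (\<lambda>x. f x *\<^sub>R u x)"
    by (auto simp: complex_eq_iff)
  finally show ?thesis .
qed

lemma has_weak_deriv_component:
  assumes "has_weak_deriv u v" and r: "bounded_linear (r :: complex \<Rightarrow> real)"
  shows "\<exists>U. primitive (\<lambda>x. r (v x)) U \<and> (AE x in lebesgue. r (u x) = U x)"
proof (rule weak_deriv_imp_primitive)
  have u: "u \<in> L_1_loc" and v: "v \<in> L_1_loc" using assms(1) by (auto simp: has_weak_deriv_def)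
  show "(\<lambda>x. r (u x)) absolutely_integrable_on {a..b}" "(\<lambda>x. r (v x)) absolutely_integrable_on {a..b}" for a b
    by (intro L_1_loc_component u v r)+
  fix \<phi> assume \<phi>: "\<phi> \<in> test_functions"
  then obtain R where R: "R > 0" "smooth \<phi>" "\<And>x. x \<notin> {-R<..<R} \<Longrightarrow> \<phi> x = 0 \<and> deriv \<phi> x = 0"
    by (elim test_functionsE) (rule that)
  have "x \<in> {-R<..<R}" if "\<phi> x \<noteq> 0 \<or> deriv \<phi> x \<noteq> 0" for x using R(3) that by blast
  then have supp: "{x. \<phi> x \<noteq> 0} \<subseteq> {-R..R}" "{x. deriv \<phi> x \<noteq> 0} \<subseteq> {-R..R}" by fastforce+
  have "(LINT x|lebesgue. deriv \<phi> x * r (u x)) = r (LINT x|lebesgue. deriv \<phi> x *\<^sub>R u x)"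
    using integral_bounded_linear[OF r integrable_test_scaleR[OF u smooth_deriv[OF R(2)] supp(2)]]
    by (simp add: linear_simps(5)[OF r])
  also have "\<dots> = r (- (LINT x|lebesgue. \<phi> x *\<^sub>R v x))"
    using assms(1) \<phi> by (simp add: has_weak_deriv_def)
  also have "\<dots> = - (LINT x|lebesgue. \<phi> x * r (v x))"
    using integral_bounded_linear[OF r integrable_test_scaleR[OF v R(2) supp(1)]]
    by (simp add: linear_simps(5)[OF r] linear_neg[OF bounded_linear.linear[OF r]])
  finally show "(LINT x|lebesgue. deriv \<phi> x * r (u x)) = - (LINT x|lebesgue. \<phi> x * r (v x))" .
qed

lemma has_weak_deriv_weak_deriv:
  assumes "weakly_differentiable u"
  shows "has_weak_deriv u (weak_deriv u)"
  unfolding weak_deriv_def using assms unfolding weakly_differentiable_def by (rule someI_ex)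

text \<open>\<open>U\<close> and \<open>U1\<close> are the continuous representatives of the
  components of the function and of its weak derivative. The coefficient \<open>k^2 + V\<close> is
  real, so the equation holds for each component separately.\<close>

lemma H_2_solution_schroedinger:
  assumes \<psi>: "\<psi> \<in> H_2" and V: "integrable lebesgue V" "integrable lebesgue (\<lambda>x. \<bar>x\<bar> * \<bar>V x\<bar>)"
    and eq: "AE x in lebesgue. weak_deriv (weak_deriv \<psi>) x = of_real (k\<^sup>2 + V x) * \<psi> x"
    and r: "bounded_linear (r :: complex \<Rightarrow> real)" and r_of_real: "\<And>c w. r (of_real c * w) = c * r w"
  shows "\<exists>U U1. schroedinger_1d k V U U1 \<and> (AE x in lebesgue. r (\<psi> x) = U x)"
proof -
  have w: "has_weak_deriv \<psi> (weak_deriv \<psi>)" "has_weak_deriv (weak_deriv \<psi>) (weak_deriv (weak_deriv \<psi>))"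
    using \<psi> by (auto simp: H_2_def intro: has_weak_deriv_weak_deriv)
  obtain U where U: "primitive (\<lambda>x. r (weak_deriv \<psi> x)) U" "AE x in lebesgue. r (\<psi> x) = U x"
    using has_weak_deriv_component[OF w(1) r] by blast
  obtain U1 where U1: "primitive (\<lambda>x. r (weak_deriv (weak_deriv \<psi>) x)) U1"
    "AE x in lebesgue. r (weak_deriv \<psi> x) = U1 x"
    using has_weak_deriv_component[OF w(2) r] by blast
  have "isCont U1 x" for x
    using primitive_continuous[OF U1(1), of UNIV] by (simp add: continuous_on_eq_continuous_at)
  then have "(U has_real_derivative U1 x) (at x)" for x
    by (rule primitive_has_derivative[OF primitive_spike[OF U(1) U1(2)]])
  moreover have "AE x in lebesgue. r (weak_deriv (weak_deriv \<psi>) x) = (k\<^sup>2 + V x) * U x"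
    using eq U(2) by eventually_elim (simp only: r_of_real)
  then have "primitive (\<lambda>x. (k\<^sup>2 + V x) * U x) U1"
    by (rule primitive_spike[OF U1(1)])
  ultimately have "schroedinger_1d k V U U1" using V by (simp add: schroedinger_1d_def)
  then show ?thesis using U(2) by blast
qed

lemma H_2_eigenfunction_bound:
  assumes \<psi>: "\<psi> \<in> H_2" and nz: "\<not> (AE x in lebesgue. \<psi> x = 0)"
    and V: "integrable lebesgue V" "integrable lebesgue (\<lambda>x. \<bar>x\<bar> * \<bar>V x\<bar>)"
    and eq: "AE x in lebesgue. weak_deriv (weak_deriv \<psi>) x = of_real (k\<^sup>2 + V x) * \<psi> x"
    and k: "k > 0" and less: "(LINT x|lebesgue. V x) < - 4 * k"
  shows "1 \<le> (LINT x|lebesgue. \<bar>x\<bar> * \<bar>V x\<bar>)"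
proof -
  have "\<not> (AE x in lebesgue. Re (\<psi> x) = 0) \<or> \<not> (AE x in lebesgue. Im (\<psi> x) = 0)"
  proof (rule ccontr)
    assume "\<not> ?thesis"
    then have "AE x in lebesgue. Re (\<psi> x) = 0" "AE x in lebesgue. Im (\<psi> x) = 0" by auto
    then have "AE x in lebesgue. \<psi> x = 0" by eventually_elim (simp add: complex_eq_iff)
    then show False using nz by blast
  qed
  \<comment> \<open>A component that does not vanish almost everywhere; the bound by
    \<open>cmod\<close> transfers square integrability to it.\<close>
  then obtain r :: "complex \<Rightarrow> real" where r: "bounded_linear r" "\<And>c w. r (of_real c * w) = c * r w"
      "\<And>w. \<bar>r w\<bar> \<le> cmod w" and r_nz: "\<not> (AE x in lebesgue. r (\<psi> x) = 0)"
  proof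
    assume "\<not> (AE x in lebesgue. Re (\<psi> x) = 0)"
    then show thesis by (intro that[of Re] bounded_linear_Re abs_Re_le_cmod) simp_all
  next
    assume "\<not> (AE x in lebesgue. Im (\<psi> x) = 0)"
    then show thesis by (intro that[of Im] bounded_linear_Im abs_Im_le_cmod) simp_all
  qed
  obtain U U1 where S: "schroedinger_1d k V U U1" and U: "AE x in lebesgue. r (\<psi> x) = U x"
    using H_2_solution_schroedinger[OF \<psi> V eq r(1,2)] by blast
  interpret schroedinger_1d k V U U1 by (rule S)
  have "integrable lebesgue (\<lambda>x. (U x)\<^sup>2)"
  proof (rule Bochner_Integration.integrable_bound)
    show "integrable lebesgue (\<lambda>x. (cmod (\<psi> x))\<^sup>2)" using \<psi> by (simp add: H_2_def L_2_def)
    have "U \<in> borel_measurable lebesgue"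
      using borel_measurable_continuous_onI[OF U_cont] by (simp add: measurable_completion)
    then show "(\<lambda>x. (U x)\<^sup>2) \<in> borel_measurable lebesgue" by measurable
    show "AE x in lebesgue. norm ((U x)\<^sup>2) \<le> norm ((cmod (\<psi> x))\<^sup>2)"
      using U
    proof eventually_elim
      case (elim x)
      then have "\<bar>U x\<bar>\<^sup>2 \<le> (cmod (\<psi> x))\<^sup>2" using r(3)[of "\<psi> x"] by (intro power_mono) auto
      then show ?case by simp
    qed
  qed
  moreover have "\<exists>x. U x \<noteq> 0"
  proof (rule ccontr)
    assume "\<nexists>x. U x \<noteq> 0"
    then have "AE x in lebesgue. r (\<psi> x) = 0" using U by simp
    then show False using r_nz by blast
  qed
  ultimately show ?thesis using k less by (rule weighted_bound)
qed

theorem theorem1p8: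
  fixes lam mu z :: real and a :: "real \<Rightarrow> real"
  assumes "mu > 0" and "lam + mu \<ge> 0"
    and "a \<in> L_infinity"
    and "integrable lebesgue (\<lambda>x. \<bar>x\<bar> * \<bar>a x\<bar>)"
    and "((\<lambda>R. linf_norm (UNIV - {-R<..<R}) a) \<longlongrightarrow> 0) at_top"
    and "damped_eigenvalue lam mu a (complex_of_real z)"
    and "(z > 0 \<and> (LINT x|lebesgue. a x) < - 4 * sqrt (lam + 2 * mu)) \<or>
         (z < 0 \<and> (LINT x|lebesgue. a x) > 4 * sqrt (lam + 2 * mu))"
  shows "\<bar>z\<bar> \<ge> (lam + 2 * mu) * inverse (LINT x|lebesgue. \<bar>x\<bar> * \<bar>a x\<bar>)"
proof -
  define \<kappa> where "\<kappa> = lam + 2 * mu"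
  define M where "M = (LINT x|lebesgue. \<bar>x\<bar> * \<bar>a x\<bar>)"
  have \<kappa>: "\<kappa> > 0" using assms(1,2) by (simp add: \<kappa>_def)
  have z: "z \<noteq> 0" using assms(7) by auto
  \<comment> \<open>The integral of a non-integrable function is 0 by convention. The strict
    inequality for the integral excludes this value and so yields the integrability of
    \<open>a\<close>.\<close>
  have int_a: "(LINT x|lebesgue. a x) \<noteq> 0"
    using assms(7) real_sqrt_gt_zero[OF \<kappa>] unfolding \<kappa>_def by linarith
  then have a: "integrable lebesgue a" by (rule contrapos_np) (rule not_integrable_integral_eq)
  \<comment> \<open>Eliminating \<open>\<psi>2 = z \<psi>\<close> leaves
    \<open>\<kappa> \<psi>'' = (z^2 + z a) \<psi>\<close>; division by \<open>\<kappa>\<close> gives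
    \<open>V\<close> and \<open>k\<close>.\<close>
  define V where "V x = z / \<kappa> * a x" for x
  define k where "k = \<bar>z\<bar> / sqrt \<kappa>"
  have k: "k > 0" "k\<^sup>2 = z\<^sup>2 / \<kappa>" using z \<kappa> by (simp_all add: k_def power_divide)
  have V: "integrable lebesgue V" unfolding V_def using a by simp
  have xV_eq: "\<bar>x\<bar> * \<bar>V x\<bar> = \<bar>z\<bar> / \<kappa> * (\<bar>x\<bar> * \<bar>a x\<bar>)" for x
    using \<kappa> by (simp add: V_def abs_mult)
  have xV: "integrable lebesgue (\<lambda>x. \<bar>x\<bar> * \<bar>V x\<bar>)" "(LINT x|lebesgue. \<bar>x\<bar> * \<bar>V x\<bar>) = \<bar>z\<bar> / \<kappa> * M"
    unfolding xV_eq M_def using assms(4) by simp_all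
  obtain \<Psi> where \<Psi>: "\<Psi> \<in> damped_domain" "\<not> (AE x in lebesgue. fst \<Psi> x = 0 \<and> snd \<Psi> x = 0)"
    "AE x in lebesgue. fst (damped_op lam mu a \<Psi>) x = of_real z * fst \<Psi> x"
    "AE x in lebesgue. snd (damped_op lam mu a \<Psi>) x = of_real z * snd \<Psi> x"
    using assms(6) unfolding damped_eigenvalue_def by blast
  define \<psi> \<psi>2 where "\<psi> = fst \<Psi>" and "\<psi>2 = snd \<Psi>"
  have \<psi>: "\<psi> \<in> H_2" using \<Psi>(1) by (auto simp: damped_domain_def \<psi>_def)
  have nz: "\<not> (AE x in lebesgue. \<psi> x = 0 \<and> \<psi>2 x = 0)" using \<Psi>(2) by (simp add: \<psi>_def \<psi>2_def)
  have eq: "AE x in lebesgue. \<psi>2 x = of_real z * \<psi> x"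
    "AE x in lebesgue. of_real \<kappa> * weak_deriv (weak_deriv \<psi>) x - of_real (a x) * \<psi>2 x = of_real z * \<psi>2 x"
    using \<Psi>(3,4) by (simp_all only: damped_op_def lame_def case_prod_beta fst_conv snd_conv \<psi>_def \<psi>2_def \<kappa>_def)
  have nz': "\<not> (AE x in lebesgue. \<psi> x = 0)"
  proof
    assume "AE x in lebesgue. \<psi> x = 0"
    then have "AE x in lebesgue. \<psi> x = 0 \<and> \<psi>2 x = 0" using eq(1) by eventually_elim simp
    then show False using nz by blast
  qed
  have eq': "AE x in lebesgue. weak_deriv (weak_deriv \<psi>) x = of_real (k\<^sup>2 + V x) * \<psi> x"
    using eq
  proof eventually_elim
    case (elim x)
    have "z\<^sup>2 + z * a x = \<kappa> * (k\<^sup>2 + V x)" using \<kappa> by (simp add: k(2) V_def distrib_left)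
    then have "of_real \<kappa> * (of_real (k\<^sup>2 + V x) * \<psi> x) = of_real (z\<^sup>2 + z * a x) * \<psi> x"
      by (simp only: of_real_mult mult.assoc)
    also have "\<dots> = of_real \<kappa> * weak_deriv (weak_deriv \<psi>) x"
    proof -
      have "of_real \<kappa> * weak_deriv (weak_deriv \<psi>) x = of_real z * \<psi>2 x + of_real (a x) * \<psi>2 x"
        using elim(2) by (simp only: diff_eq_eq)
      then show ?thesis unfolding elim(1) by (simp only: power2_eq_square of_real_mult of_real_add ring_distribs mult_ac)
    qed
    finally have "of_real (k\<^sup>2 + V x) * \<psi> x = weak_deriv (weak_deriv \<psi>) x"
      using \<kappa> by (subst (asm) mult_cancel_left) simp
    then show ?case by (rule sym)
  qed
  have less: "(LINT x|lebesgue. V x) < - 4 * k"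
  proof -
    \<comment> \<open>Multiplication by \<open>z\<close> merges the two sign cases of the hypothesis
      into one inequality.\<close>
    have "z * (LINT x|lebesgue. a x) < - 4 * \<bar>z\<bar> * sqrt \<kappa>"
      using assms(7)
    proof
      assume "z > 0 \<and> (LINT x|lebesgue. a x) < - 4 * sqrt (lam + 2 * mu)"
      then show ?thesis using mult_strict_left_mono[of "LINT x|lebesgue. a x" "- 4 * sqrt \<kappa>" z]
        by (simp add: \<kappa>_def)
    next
      assume "z < 0 \<and> (LINT x|lebesgue. a x) > 4 * sqrt (lam + 2 * mu)"
      then show ?thesis using mult_strict_left_mono_neg[of "4 * sqrt \<kappa>" "LINT x|lebesgue. a x" z]
        by (simp add: \<kappa>_def)
    qed
    then have "z * (LINT x|lebesgue. a x) / \<kappa> < - 4 * \<bar>z\<bar> * sqrt \<kappa> / \<kappa>"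
      using \<kappa> by (rule divide_strict_right_mono)
    also have "- 4 * \<bar>z\<bar> * sqrt \<kappa> / \<kappa> = - 4 * \<bar>z\<bar> * (1 / sqrt \<kappa>)"
    proof -
      have "sqrt \<kappa> / \<kappa> = 1 / sqrt \<kappa>" using real_divide_square_eq[of "sqrt \<kappa>" 1] \<kappa> by simp
      then show ?thesis unfolding times_divide_eq_right[symmetric] by (rule arg_cong)
    qed
    also have "\<dots> = - 4 * k" by (simp add: k_def)
    finally show ?thesis unfolding V_def by simp
  qed
  have "1 \<le> \<bar>z\<bar> / \<kappa> * M"
    using H_2_eigenfunction_bound[OF \<psi> nz' V xV(1) eq' k(1) less] unfolding xV(2) .
  then have le: "\<kappa> \<le> \<bar>z\<bar> * M" using \<kappa> by (simp add: pos_le_divide_eq)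
  \<comment> \<open>Positivity of \<open>M\<close> is what allows the division: for
    \<open>M = 0\<close> the value of \<open>inverse M\<close> would be 0.\<close>
  then have "0 < \<bar>z\<bar> * M" using \<kappa> by linarith
  then have "M > 0" using z by (simp add: zero_less_mult_iff)
  then have "\<kappa> * inverse M \<le> \<bar>z\<bar>" using le by (simp add: divide_inverse[symmetric] pos_divide_le_eq)
  then show ?thesis unfolding \<kappa>_def M_def .
qed

end
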